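(* Let $S_1$ and $S_2$ be right LCM semigroups with identity. Let $(\tilde v_p)_{p\in S_1}$ and $(v_p)_{p\in S_2}$ be the families of generating isometries of the full semigroup $C^*$-algebras $C^*(S_1)$ and $C^*(S_2)$, respectively. Let $\phi:S_1\to S_2$ be an identity preserving semigroup homomorphism. Then $\phi$ induces a $*$-homomorphism $\varphi:C^*(S_1)\to C^*(S_2)$ with $\varphi(\tilde v_p)=v_{\phi(p)}$ for all $p\in S_1$ if and only if $$\phi(p)S_2\cap\phi(q)S_2=\phi(pS_1\cap qS_1)S_2\quad\text{for all }p,q\in S_1 .$$
   Context: A (discrete) semigroup $S$ with identity is right LCM if it is left cancellative and, for all $p,q\in S$, the set $pS\cap qS$ is either empty or equal to $rS$ for some $r\in S$. For subsets, $\phi(X)S_2=\{\phi(x)s\mid x\in X,\ s\in S_2\}$, which is empty if $X=\emptyset$. For a left cancellative semigroup $S$ with identity, a right ideal is a subset closed under right multiplication by elements of $S$; for a right ideal $X$ and $p\in S$ put $pX=\{px\mid x\in X\}$ and $p^{-1}X=\{y\in S\mid py\in X\}$. The family $\mathcal J(S)$ of constructible right ideals is the smallest family of right ideals containing $S$ and $\emptyset$ and closed under $X\mapsto pX$ and $X\mapsto p^{-1}X$ for all $p\in S$ (it is also closed under finite intersections; for right LCM $S$ with identity, $\mathcal J(S)=\{\emptyset\}\cup\{pS\mid p\in S\}$). The full semigroup $C^*$-algebra $C^*(S)$ is the universal $C^*$-algebra generated by isometries $(v_p)_{p\in S}$ and projections $(e_X)_{X\in\mathcal J(S)}$ satisfying,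 for all $p,q\in S$ and $X,Y\in\mathcal J(S)$: (L1) $v_pv_q=v_{pq}$; (L2) $v_pe_Xv_p^*=e_{pX}$; (L3) $e_\emptyset=0$ and $e_S=1$; (L4) $e_Xe_Y=e_{X\cap Y}$. *)

theory Defs
  imports "HOL-Analysis.Analysis" "HOL-Library.Poly_Mapping"
begin

section \<open>Unital C*-algebras\<close>

text \<open>All C*-algebras here are unital.  The zero algebra is not excluded, which is why the class
  extends \<^class>\<open>monoid_mult\<close> rather than \<^class>\<open>ring_1\<close>.\<close>

class cstar_algebra = real_normed_algebra + monoid_mult + banach +
  fixes scaleC :: "complex \<Rightarrow> 'a \<Rightarrow> 'a" (infixr \<open>*\<^sub>C\<close> 75)
    and star :: "'a \<Rightarrow> 'a"
  assumes scaleC_add_right: "c *\<^sub>C (x + y) = c *\<^sub>C x + c *\<^sub>C y"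
    and scaleC_add_left: "(c + d) *\<^sub>C x = c *\<^sub>C x + d *\<^sub>C x"
    and scaleC_scaleC: "c *\<^sub>C d *\<^sub>C x = (c * d) *\<^sub>C x"
    and scaleR_scaleC: "r *\<^sub>R x = complex_of_real r *\<^sub>C x"
    and scaleC_mult_left: "(c *\<^sub>C x) * y = c *\<^sub>C (x * y)"
    and scaleC_mult_right: "x * (c *\<^sub>C y) = c *\<^sub>C (x * y)"
    and norm_scaleC: "norm (c *\<^sub>C x) = norm c * norm x"
    and star_star: "star (star x) = x"
    and star_add: "star (x + y) = star x + star y"
    and star_scaleC: "star (c *\<^sub>C x) = cnj c *\<^sub>C star x"
    and star_mult: "star (x * y) = star y * star x"
    and norm_star_mult_self: "norm (star x * x) = (norm x)\<^sup>2"

definition star_homomorphism :: "('a::cstar_algebra \<Rightarrow> 'b::cstar_algebra) \<Rightarrow> bool" where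
  "star_homomorphism F \<longleftrightarrow>
     (\<forall>x y. F (x + y) = F x + F y) \<and> (\<forall>c x. F (c *\<^sub>C x) = c *\<^sub>C F x) \<and>
     (\<forall>x y. F (x * y) = F x * F y) \<and> (\<forall>x. F (star x) = star (F x))"

definition is_isometry :: "'a::cstar_algebra \<Rightarrow> bool" where
  "is_isometry v \<longleftrightarrow> star v * v = 1"

definition is_projection :: "'a::cstar_algebra \<Rightarrow> bool" where
  "is_projection e \<longleftrightarrow> star e = e \<and> e * e = e"


section \<open>Semigroups with identity and constructible right ideals\<close>

class left_cancel_monoid = monoid_mult +
  assumes left_cancel: "a * b = a * c \<Longrightarrow> b = c"

class right_lcm_monoid = left_cancel_monoid +
  assumes right_lcm: "range ((*) p) \<inter> range ((*) q) = {} \<or>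
    (\<exists>r. range ((*) p) \<inter> range ((*) q) = range ((*) r))"

definition set_mult :: "'a::monoid_mult set \<Rightarrow> 'a set \<Rightarrow> 'a set" where
  "set_mult X Y = {x * y |x y. x \<in> X \<and> y \<in> Y}"

definition right_ideal :: "'a::monoid_mult set \<Rightarrow> bool" where
  "right_ideal X \<longleftrightarrow> (\<forall>x\<in>X. \<forall>s. x * s \<in> X)"

text \<open>All members of this family are automatically right ideals.\<close>

inductive_set constructible :: "'a::monoid_mult set set" where
  whole: "UNIV \<in> constructible"
| empty: "{} \<in> constructible"
| image: "X \<in> constructible \<Longrightarrow> (*) p ` X \<in> constructible"
| preimage: "X \<in> constructible \<Longrightarrow> (*) p -` X \<in> constructible"

lemma constructible_right_ideal: "X \<in> constructible \<Longrightarrow> right_ideal X"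
  by (induction rule: constructible.induct) (auto simp: right_ideal_def mult.assoc)

lemma constructible_Int:
  fixes X Y :: "'a::left_cancel_monoid set"
  assumes "X \<in> constructible" "Y \<in> constructible"
  shows "X \<inter> Y \<in> constructible"
  using assms
proof (induction arbitrary: Y rule: constructible.induct)
  case (image X p)
  have "(*) p ` X \<inter> Y = (*) p ` (X \<inter> (*) p -` Y)" by auto
  then show ?case using image by (simp add: constructible.intros)
next
  case (preimage X p)
  have "(*) p -` X \<inter> Y = (*) p -` (X \<inter> (*) p ` Y)"
    by (auto dest: left_cancel)
  then show ?case using preimage by (metis constructible.image constructible.preimage)
qed (auto intro: constructible.intros)

typedef (overloaded) 'a cideal = "constructible :: 'a::left_cancel_monoid set set"
  using constructible.empty by blast

setup_lifting type_definition_cideal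

lift_definition cideal_whole :: "'a::left_cancel_monoid cideal" is UNIV
  by (rule constructible.whole)
lift_definition cideal_empty :: "'a::left_cancel_monoid cideal" is "{}"
  by (rule constructible.empty)
lift_definition cideal_mult :: "'a::left_cancel_monoid \<Rightarrow> 'a cideal \<Rightarrow> 'a cideal"
  is "\<lambda>p X. (*) p ` X" by (rule constructible.image)
lift_definition cideal_inter :: "'a::left_cancel_monoid cideal \<Rightarrow> 'a cideal \<Rightarrow> 'a cideal"
  is "(\<inter>)" by (rule constructible_Int)

definition semigroup_relations ::
  "('a::left_cancel_monoid \<Rightarrow> 'b::cstar_algebra) \<Rightarrow> ('a cideal \<Rightarrow> 'b) \<Rightarrow> bool" where
  "semigroup_relations v e \<longleftrightarrow>
     (\<forall>p. is_isometry (v p)) \<and> (\<forall>X. is_projection (e X)) \<and>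
     (\<forall>p q. v p * v q = v (p * q)) \<and>
     (\<forall>p X. v p * e X * star (v p) = e (cideal_mult p X)) \<and>
     e cideal_empty = 0 \<and> e cideal_whole = 1 \<and>
     (\<forall>X Y. e X * e Y = e (cideal_inter X Y))"


section \<open>The free unital *-algebra on a set of generators\<close>

datatype 'g letter = Gen 'g | Adj 'g
datatype 'g star_word = Word (letters: "'g letter list")

instantiation star_word :: (type) monoid_add
begin
definition "0 = Word []"
definition "v + w = Word (letters v @ letters w)"
instance by standard (auto simp: zero_star_word_def plus_star_word_def)
end

text \<open>Finitely supported functions on the monoid of words (written additively), with the
  convolution product of \<^theory>\<open>HOL-Library.Poly_Mapping\<close>.\<close>

type_synonym 'g free_star_algebra = "'g star_word \<Rightarrow>\<^sub>0 complex"

definition free_gen :: "'g \<Rightarrow> 'g free_star_algebra" where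
  "free_gen g = Poly_Mapping.single (Word [Gen g]) 1"

definition free_scale :: "complex \<Rightarrow> 'g free_star_algebra \<Rightarrow> 'g free_star_algebra" where
  "free_scale c = Poly_Mapping.map ((*) c)"

fun letter_star :: "'g letter \<Rightarrow> 'g letter" where
  "letter_star (Gen g) = Adj g"
| "letter_star (Adj g) = Gen g"

definition word_star :: "'g star_word \<Rightarrow> 'g star_word" where
  "word_star w = Word (rev (map letter_star (letters w)))"

definition free_star :: "'g free_star_algebra \<Rightarrow> 'g free_star_algebra" where
  "free_star x = Poly_Mapping.map_key word_star (Poly_Mapping.map cnj x)"

lemma letter_star_letter_star [simp]: "letter_star (letter_star a) = a"
  by (cases a) auto

lemma word_star_word_star [simp]: "word_star (word_star w) = w"
  by (cases w) (simp add: word_star_def rev_map comp_def)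

lemma word_star_add: "word_star (v + w) = word_star w + word_star v"
  by (simp add: word_star_def plus_star_word_def)

lemma word_star_zero [simp]: "word_star 0 = 0"
  by (simp add: word_star_def zero_star_word_def)

lemma inj_word_star: "inj word_star"
  by (metis injI word_star_word_star)

lemma free_scale_conv_mult: "free_scale c x = Poly_Mapping.single 0 c * x"
  by (simp add: free_scale_def mult_map_scale_conv_mult)

lemma lookup_free_scale: "Poly_Mapping.lookup (free_scale c x) w = c * Poly_Mapping.lookup x w"
  by (simp add: free_scale_def Poly_Mapping.map.rep_eq when_def)

lemma lookup_free_star: "Poly_Mapping.lookup (free_star x) w = cnj (Poly_Mapping.lookup x (word_star w))"
proof -
  have "Poly_Mapping.lookup (Poly_Mapping.map cnj x) v = cnj (Poly_Mapping.lookup x v)" for v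
    by (simp add: Poly_Mapping.map.rep_eq when_def)
  then show ?thesis
    unfolding free_star_def by (simp add: map_key.rep_eq[OF inj_word_star])
qed

lemma free_star_single: "free_star (Poly_Mapping.single w c) = Poly_Mapping.single (word_star w) (cnj c)"
  by (rule poly_mapping_eqI) (auto simp: lookup_free_star lookup_single when_def)

lemma free_star_add: "free_star (x + y) = free_star x + free_star y"
  by (rule poly_mapping_eqI) (simp add: lookup_free_star lookup_add)

lemma free_star_uminus: "free_star (- x) = - free_star x"
  by (rule poly_mapping_eqI) (simp add: lookup_free_star)

lemma free_star_diff: "free_star (x - y) = free_star x - free_star y"
  by (rule poly_mapping_eqI) (simp add: lookup_free_star lookup_minus)

lemma free_star_zero: "free_star 0 = 0"
  by (rule poly_mapping_eqI) (simp add: lookup_free_star)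

lemma free_star_one: "free_star 1 = 1"
  unfolding single_one[symmetric] by (simp only: free_star_single word_star_zero) simp

lemma free_star_star: "free_star (free_star x) = x"
  by (rule poly_mapping_eqI) (simp add: lookup_free_star)

lemma free_star_scale: "free_star (free_scale c x) = free_scale (cnj c) (free_star x)"
  by (rule poly_mapping_eqI) (simp add: lookup_free_star lookup_free_scale)

lemma poly_mapping_add_induct [case_names zero single add]:
  fixes x :: "'k \<Rightarrow>\<^sub>0 'c::comm_monoid_add"
  assumes zero: "P 0" and single: "\<And>k c. P (Poly_Mapping.single k c)"
    and add: "\<And>x y. P x \<Longrightarrow> P y \<Longrightarrow> P (x + y)"
  shows "P x"
proof (induction x rule: update_induct)
  case (update f a b)
  have "Poly_Mapping.update a b f = Poly_Mapping.single a b + f"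
    using update(1) by (intro poly_mapping_eqI)
      (auto simp: lookup_update lookup_add lookup_single when_def in_keys_iff)
  then show ?case using single update add by simp
qed (rule zero)

lemma free_star_mult: "free_star (x * y) = free_star y * free_star x"
proof (induction x rule: poly_mapping_add_induct)
  case (single k c)
  show ?case
    by (induction y rule: poly_mapping_add_induct)
      (simp_all add: free_star_zero free_star_add free_star_single mult_single word_star_add
        distrib_left distrib_right mult.commute)
qed (simp_all add: free_star_zero free_star_add distrib_left distrib_right)

lemma free_scale_single: "free_scale c (Poly_Mapping.single w d) = Poly_Mapping.single w (c * d)"
  by (simp add: free_scale_conv_mult mult_single)

lemma free_scale_add_right: "free_scale c (x + y) = free_scale c x + free_scale c y"
  by (simp add: free_scale_conv_mult distrib_left)

lemma free_scale_diff_right: "free_scale c (x - y) = free_scale c x - free_scale c y"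
  by (simp add: free_scale_conv_mult right_diff_distrib)

lemma free_scale_add_left: "free_scale (c + d) x = free_scale c x + free_scale d x"
  by (simp add: free_scale_conv_mult single_add distrib_right)

lemma free_scale_scale: "free_scale c (free_scale d x) = free_scale (c * d) x"
  by (simp add: free_scale_conv_mult mult.assoc[symmetric] mult_single)

lemma free_scale_one: "free_scale 1 x = x"
  by (simp add: free_scale_conv_mult)

lemma free_scale_minus_one: "free_scale (- 1) x = - x"
  by (simp add: free_scale_conv_mult single_uminus)

lemma free_scale_zero_left: "free_scale 0 x = 0"
  by (simp add: free_scale_conv_mult)

lemma free_scale_mult_left: "free_scale c x * y = free_scale c (x * y)"
  by (simp add: free_scale_conv_mult mult.assoc)

lemma free_scale_mult_right: "x * free_scale c y = free_scale c (x * y)"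
proof (induction x rule: poly_mapping_add_induct)
  case (single k d)
  show ?case
    by (simp add: free_scale_conv_mult mult.assoc[symmetric] mult_single mult.commute)
qed (simp_all add: free_scale_conv_mult distrib_left distrib_right)


section \<open>C*-seminorms and completion\<close>

definition cstar_seminorm :: "('g free_star_algebra \<Rightarrow> real) \<Rightarrow> bool" where
  "cstar_seminorm N \<longleftrightarrow>
     (\<forall>x y. N (x + y) \<le> N x + N y) \<and> (\<forall>c x. N (free_scale c x) = cmod c * N x) \<and>
     (\<forall>x y. N (x * y) \<le> N x * N y) \<and> (\<forall>x. N (free_star x * x) = (N x)\<^sup>2)"

text \<open>The universal C*-algebra on generators \<open>'g\<close> with relations \<open>r = 0\<close> for \<open>r \<in> R\<close> is the
  Hausdorff completion of the free unital *-algebra with respect to this seminorm.  The supremum is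
  only meaningful if it is finite for every \<open>x\<close>; for the relations used below this is shown in
  \<open>bdd_full_seminorm\<close>.\<close>

definition universal_seminorm :: "'g free_star_algebra set \<Rightarrow> 'g free_star_algebra \<Rightarrow> real" where
  "universal_seminorm R x = Sup {N x |N. cstar_seminorm N \<and> (\<forall>r\<in>R. N r = 0)}"

definition seminorm_Cauchy :: "('g free_star_algebra \<Rightarrow> real) \<Rightarrow> (nat \<Rightarrow> 'g free_star_algebra) \<Rightarrow> bool" where
  "seminorm_Cauchy N X \<longleftrightarrow> (\<forall>\<epsilon>>0. \<exists>M. \<forall>m\<ge>M. \<forall>n\<ge>M. N (X m - X n) < \<epsilon>)"

definition completion_rel ::
  "('g free_star_algebra \<Rightarrow> real) \<Rightarrow> (nat \<Rightarrow> 'g free_star_algebra) \<Rightarrow> (nat \<Rightarrow> 'g free_star_algebra) \<Rightarrow> bool" where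
  "completion_rel N X Y \<longleftrightarrow>
     seminorm_Cauchy N X \<and> seminorm_Cauchy N Y \<and> (\<lambda>n. N (X n - Y n)) \<longlonglongrightarrow> 0"

context
  fixes N :: "'g free_star_algebra \<Rightarrow> real"
  assumes N: "cstar_seminorm N"
begin

lemma sn_add: "N (x + y) \<le> N x + N y"
  and sn_scale: "N (free_scale c x) = cmod c * N x"
  and sn_mult: "N (x * y) \<le> N x * N y"
  and sn_star_mult_self: "N (free_star x * x) = (N x)\<^sup>2"
  using N by (auto simp: cstar_seminorm_def)

lemma sn_zero [simp]: "N 0 = 0"
  using sn_scale[of 0 0] by (simp add: free_scale_zero_left)

lemma sn_uminus: "N (- x) = N x"
  using sn_scale[of "-1" x] by (simp add: free_scale_minus_one)

lemma sn_minus_commute: "N (x - y) = N (y - x)"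
  using sn_uminus[of "x - y"] by simp

lemma sn_nonneg [simp]: "0 \<le> N x"
  using sn_add[of x "- x"] sn_uminus[of x] by simp

lemma sn_star: "N (free_star x) = N x"
proof -
  have le: "N x \<le> N (free_star x)" for x
  proof -
    have "(N x)\<^sup>2 \<le> N (free_star x) * N x"
      using sn_mult[of "free_star x" x] sn_star_mult_self[of x] by simp
    then show ?thesis
      using sn_nonneg[of x] sn_nonneg[of "free_star x"]
      by (cases "N x = 0") (auto simp: power2_eq_square)
  qed
  show ?thesis using le[of x] le[of "free_star x"] by (simp add: free_star_star)
qed

lemma sn_one_le: "N 1 \<le> 1"
proof -
  have "N 1 = (N 1)\<^sup>2" using sn_star_mult_self[of 1] by (simp add: free_star_one)
  then have "N 1 = 0 \<or> N 1 = 1" by (auto simp: power2_eq_square)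
  then show ?thesis by auto
qed

lemma sn_triangle: "N (x - z) \<le> N (x - y) + N (y - z)"
  using sn_add[of "x - y" "y - z"] by simp

lemma sn_diff_le: "N x - N y \<le> N (x - y)"
  using sn_add[of "x - y" y] by simp

lemma sn_abs_diff: "\<bar>N x - N y\<bar> \<le> N (x - y)"
  using sn_diff_le[of x y] sn_diff_le[of y x] sn_minus_commute[of x y] by simp

lemma sn_diff_add: "N ((x + y) - (x' + y')) \<le> N (x - x') + N (y - y')"
  using sn_add[of "x - x'" "y - y'"] by (simp add: algebra_simps)

lemma sn_diff_mult: "N (x * y - x' * y') \<le> N (x - x') * N y + N x' * N (y - y')"
proof -
  have "x * y - x' * y' = (x - x') * y + x' * (y - y')" by (simp add: algebra_simps)
  then show ?thesis
    using sn_add[of "(x - x') * y" "x' * (y - y')"] sn_mult[of "x - x'" y] sn_mult[of x' "y - y'"]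
    by simp
qed

lemma sn_Cauchy_const: "seminorm_Cauchy N (\<lambda>n. x)"
  by (simp add: seminorm_Cauchy_def)

lemma sn_Cauchy_norm: assumes "seminorm_Cauchy N X" shows "Cauchy (\<lambda>n. N (X n))"
proof (rule metric_CauchyI)
  fix e :: real assume "e > 0"
  then obtain M where "\<forall>m\<ge>M. \<forall>n\<ge>M. N (X m - X n) < e"
    using assms by (auto simp: seminorm_Cauchy_def)
  then show "\<exists>M. \<forall>m\<ge>M. \<forall>n\<ge>M. dist (N (X m)) (N (X n)) < e"
    by (metis dist_real_def order_le_less_trans sn_abs_diff)
qed

lemma sn_Cauchy_bound: assumes "seminorm_Cauchy N X" obtains K where "K > 0" "\<And>n. N (X n) \<le> K"
proof -
  have "Bseq (\<lambda>n. N (X n))" using sn_Cauchy_norm[OF assms] by (rule Cauchy_Bseq)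
  then obtain K where "K > 0" "\<And>n. norm (N (X n)) \<le> K" by (auto simp: Bseq_def)
  then show ?thesis using that by force
qed

lemma sn_Cauchy_dominated:
  assumes "seminorm_Cauchy N X" "seminorm_Cauchy N Y" "K > 0" "L > 0"
    and "\<And>m n. N (Z m - Z n) \<le> K * N (X m - X n) + L * N (Y m - Y n)"
  shows "seminorm_Cauchy N Z"
  unfolding seminorm_Cauchy_def
proof (intro allI impI)
  fix e :: real assume e: "e > 0"
  obtain A where A: "\<And>m n. m \<ge> A \<Longrightarrow> n \<ge> A \<Longrightarrow> N (X m - X n) < e / (2 * K)"
    using assms(1) e \<open>K > 0\<close> unfolding seminorm_Cauchy_def
    by (meson divide_pos_pos mult_pos_pos zero_less_numeral)
  obtain B where B: "\<And>m n. m \<ge> B \<Longrightarrow> n \<ge> B \<Longrightarrow> N (Y m - Y n) < e / (2 * L)"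
    using assms(2) e \<open>L > 0\<close> unfolding seminorm_Cauchy_def
    by (meson divide_pos_pos mult_pos_pos zero_less_numeral)
  have "N (Z m - Z n) < e" if "m \<ge> max A B" "n \<ge> max A B" for m n
  proof -
    have "K * N (X m - X n) < e / 2" "L * N (Y m - Y n) < e / 2"
      using A[of m n] B[of m n] that assms(3,4) by (auto simp: field_simps)
    then show ?thesis using assms(5)[of m n] by linarith
  qed
  then show "\<exists>M. \<forall>m\<ge>M. \<forall>n\<ge>M. N (Z m - Z n) < e" by blast
qed

lemma sn_Cauchy_add:
  "seminorm_Cauchy N X \<Longrightarrow> seminorm_Cauchy N Y \<Longrightarrow> seminorm_Cauchy N (\<lambda>n. X n + Y n)"
  by (rule sn_Cauchy_dominated[where K = 1 and L = 1 and X = X and Y = Y]) (auto simp: sn_diff_add)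

lemma sn_Cauchy_scale: "seminorm_Cauchy N X \<Longrightarrow> seminorm_Cauchy N (\<lambda>n. free_scale c (X n))"
  by (rule sn_Cauchy_dominated[where K = "cmod c + 1" and L = 1 and Y = "\<lambda>n. 0"])
    (auto simp: free_scale_diff_right[symmetric] sn_scale add_nonneg_pos sn_Cauchy_const
      intro!: mult_right_mono)

lemma sn_Cauchy_uminus: "seminorm_Cauchy N X \<Longrightarrow> seminorm_Cauchy N (\<lambda>n. - X n)"
  using sn_Cauchy_scale[of X "-1"] by (simp add: free_scale_minus_one)

lemma sn_Cauchy_star: "seminorm_Cauchy N X \<Longrightarrow> seminorm_Cauchy N (\<lambda>n. free_star (X n))"
  by (simp add: seminorm_Cauchy_def free_star_diff[symmetric] sn_star)

lemma sn_Cauchy_mult: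
  assumes X: "seminorm_Cauchy N X" and Y: "seminorm_Cauchy N Y"
  shows "seminorm_Cauchy N (\<lambda>n. X n * Y n)"
proof -
  obtain K where K: "K > 0" "\<And>n. N (X n) \<le> K" by (rule sn_Cauchy_bound[OF X]) blast
  obtain L where L: "L > 0" "\<And>n. N (Y n) \<le> L" by (rule sn_Cauchy_bound[OF Y]) blast
  show ?thesis
  proof (rule sn_Cauchy_dominated[OF X Y L(1) K(1)])
    fix m n
    show "N (X m * Y m - X n * Y n) \<le> L * N (X m - X n) + K * N (Y m - Y n)"
      using sn_diff_mult[of "X m" "Y m" "X n" "Y n"]
        mult_left_mono[OF L(2)[of m] sn_nonneg[of "X m - X n"]]
        mult_right_mono[OF K(2)[of n] sn_nonneg[of "Y m - Y n"]]
      by (simp add: mult.commute)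
  qed
qed

lemma completion_rel_add:
  assumes "completion_rel N X X'" "completion_rel N Y Y'"
  shows "completion_rel N (\<lambda>n. X n + Y n) (\<lambda>n. X' n + Y' n)"
proof -
  have lim: "(\<lambda>n. N (X n - X' n) + N (Y n - Y' n)) \<longlonglongrightarrow> 0"
    using tendsto_add[of "\<lambda>n. N (X n - X' n)" 0 sequentially "\<lambda>n. N (Y n - Y' n)" 0] assms
    by (simp add: completion_rel_def)
  have "(\<lambda>n. N (X n + Y n - (X' n + Y' n))) \<longlonglongrightarrow> 0"
  proof (rule Lim_null_comparison[OF always_eventually lim], rule allI)
    fix n
    show "norm (N (X n + Y n - (X' n + Y' n))) \<le> N (X n - X' n) + N (Y n - Y' n)"
      using sn_diff_add[of "X n" "Y n" "X' n" "Y' n"] sn_nonneg[of "X n + Y n - (X' n + Y' n)"]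
      unfolding real_norm_def by linarith
  qed
  then show ?thesis using assms unfolding completion_rel_def by (blast intro: sn_Cauchy_add)
qed

lemma completion_rel_scale:
  assumes "completion_rel N X X'"
  shows "completion_rel N (\<lambda>n. free_scale c (X n)) (\<lambda>n. free_scale c (X' n))"
proof -
  have "(\<lambda>n. cmod c * N (X n - X' n)) \<longlonglongrightarrow> cmod c * 0"
    using assms by (intro tendsto_mult) (auto simp: completion_rel_def)
  then show ?thesis
    using assms sn_Cauchy_scale by (auto simp: completion_rel_def free_scale_diff_right[symmetric] sn_scale)
qed

lemma completion_rel_uminus:
  "completion_rel N X X' \<Longrightarrow> completion_rel N (\<lambda>n. - X n) (\<lambda>n. - X' n)"
  using completion_rel_scale[of X X' "-1"] by (simp add: free_scale_minus_one)

lemma completion_rel_diff: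
  assumes "completion_rel N X X'" "completion_rel N Y Y'"
  shows "completion_rel N (\<lambda>n. X n - Y n) (\<lambda>n. X' n - Y' n)"
  using completion_rel_add[OF assms(1) completion_rel_uminus[OF assms(2)]] by simp

lemma completion_rel_star:
  "completion_rel N X X' \<Longrightarrow> completion_rel N (\<lambda>n. free_star (X n)) (\<lambda>n. free_star (X' n))"
  by (simp add: completion_rel_def sn_Cauchy_star free_star_diff[symmetric] sn_star)

lemma completion_rel_mult:
  assumes X: "completion_rel N X X'" and Y: "completion_rel N Y Y'"
  shows "completion_rel N (\<lambda>n. X n * Y n) (\<lambda>n. X' n * Y' n)"
proof -
  obtain K where K: "K > 0" "\<And>n. N (X' n) \<le> K"
    using sn_Cauchy_bound X by (metis completion_rel_def)
  obtain L where L: "L > 0" "\<And>n. N (Y n) \<le> L"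
    using sn_Cauchy_bound Y by (metis completion_rel_def)
  have lim: "(\<lambda>n. L * N (X n - X' n) + K * N (Y n - Y' n)) \<longlonglongrightarrow> 0"
  proof -
    have "(\<lambda>n. L * N (X n - X' n)) \<longlonglongrightarrow> 0" "(\<lambda>n. K * N (Y n - Y' n)) \<longlonglongrightarrow> 0"
      using X Y by (auto simp: completion_rel_def intro: tendsto_mult_right_zero)
    from tendsto_add[OF this] show ?thesis by simp
  qed
  have "(\<lambda>n. N (X n * Y n - X' n * Y' n)) \<longlonglongrightarrow> 0"
  proof (rule Lim_null_comparison[OF always_eventually lim], rule allI)
    fix n
    have "N (X n - X' n) * N (Y n) \<le> N (X n - X' n) * L"
      "N (X' n) * N (Y n - Y' n) \<le> K * N (Y n - Y' n)"
      using K(2)[of n] L(2)[of n] by (auto intro: mult_left_mono mult_right_mono)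
    then show "norm (N (X n * Y n - X' n * Y' n)) \<le> L * N (X n - X' n) + K * N (Y n - Y' n)"
      using sn_diff_mult[of "X n" "Y n" "X' n" "Y' n"] sn_nonneg[of "X n * Y n - X' n * Y' n"]
      unfolding real_norm_def mult.commute[of L] by linarith
  qed
  then show ?thesis using X Y unfolding completion_rel_def by (blast intro: sn_Cauchy_mult)
qed

lemma completion_rel_refl_iff: "completion_rel N X X \<longleftrightarrow> seminorm_Cauchy N X"
  by (simp add: completion_rel_def)

lemma part_equivp_completion_rel: "part_equivp (completion_rel N)"
proof (rule part_equivpI)
  show "\<exists>X. completion_rel N X X"
    by (rule exI[of _ "\<lambda>n. 0"]) (simp add: completion_rel_refl_iff sn_Cauchy_const)
  show "symp (completion_rel N)"
    by (rule sympI) (simp add: completion_rel_def sn_minus_commute)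
  show "transp (completion_rel N)"
  proof (rule transpI)
    fix X Y Z assume XY: "completion_rel N X Y" and YZ: "completion_rel N Y Z"
    have lim: "(\<lambda>n. N (X n - Y n) + N (Y n - Z n)) \<longlonglongrightarrow> 0"
      using tendsto_add[of "\<lambda>n. N (X n - Y n)" 0 sequentially "\<lambda>n. N (Y n - Z n)" 0] XY YZ
      by (simp add: completion_rel_def)
    have "(\<lambda>n. N (X n - Z n)) \<longlonglongrightarrow> 0"
    proof (rule Lim_null_comparison[OF always_eventually lim], rule allI)
      fix n
      show "norm (N (X n - Z n)) \<le> N (X n - Y n) + N (Y n - Z n)"
        using sn_triangle[of "X n" "Z n" "Y n"] sn_nonneg[of "X n - Z n"]
        unfolding real_norm_def by linarith
    qed
    then show "completion_rel N X Z" using XY YZ unfolding completion_rel_def by blast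
  qed
qed

lemma sn_Cauchy_convergent: "seminorm_Cauchy N X \<Longrightarrow> convergent (\<lambda>n. N (X n))"
  using sn_Cauchy_norm Cauchy_convergent_iff by blast

lemma completion_rel_lim:
  assumes "completion_rel N X Y" shows "lim (\<lambda>n. N (X n)) = lim (\<lambda>n. N (Y n))"
proof -
  have lim0: "(\<lambda>n. N (X n - Y n)) \<longlonglongrightarrow> 0" using assms by (simp add: completion_rel_def)
  have "(\<lambda>n. N (X n) - N (Y n)) \<longlonglongrightarrow> 0"
    by (rule Lim_null_comparison[OF always_eventually lim0]) (simp add: sn_abs_diff)
  from tendsto_add[OF this, of "\<lambda>n. N (Y n)" "lim (\<lambda>n. N (Y n))"]
  have "(\<lambda>n. N (X n)) \<longlonglongrightarrow> lim (\<lambda>n. N (Y n))"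
    using assms sn_Cauchy_convergent[of Y] by (simp add: completion_rel_def convergent_LIMSEQ_iff)
  then show ?thesis by (rule limI)
qed

end

lemma cstar_seminorm_zero: "cstar_seminorm (\<lambda>x. 0)"
  by (simp add: cstar_seminorm_def)

lemma cstar_seminorm_universal:
  assumes bdd: "\<And>x. bdd_above {N x |N. cstar_seminorm N \<and> (\<forall>r\<in>R. N r = 0)}"
  shows "cstar_seminorm (universal_seminorm R)"
proof -
  let ?P = "\<lambda>N. cstar_seminorm N \<and> (\<forall>r\<in>R. N r = 0)"
  let ?U = "universal_seminorm R"
  have upper: "N x \<le> ?U x" if "?P N" for N x
    unfolding universal_seminorm_def using that by (intro cSup_upper bdd) blast
  have least: "?U x \<le> b" if "\<And>N. ?P N \<Longrightarrow> N x \<le> b" for x b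
    unfolding universal_seminorm_def using cstar_seminorm_zero
    by (intro cSup_least) (auto simp: that)
  have nonneg: "0 \<le> ?U x" for x using upper[of "\<lambda>x. 0" x] cstar_seminorm_zero by auto
  have add: "?U (x + y) \<le> ?U x + ?U y" for x y
  proof (rule least)
    fix N assume N: "?P N"
    then have "N (x + y) \<le> N x + N y" by (simp add: sn_add)
    then show "N (x + y) \<le> ?U x + ?U y" using upper[OF N, of x] upper[OF N, of y] by linarith
  qed
  have mult: "?U (x * y) \<le> ?U x * ?U y" for x y
  proof (rule least)
    fix N assume N: "?P N"
    then have "N (x * y) \<le> N x * N y" by (simp add: sn_mult)
    also have "\<dots> \<le> ?U x * ?U y"
      using N by (intro mult_mono upper nonneg) auto
    finally show "N (x * y) \<le> ?U x * ?U y" .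
  qed
  have scale_le: "?U (free_scale c x) \<le> cmod c * ?U x" for c x
    by (rule least) (simp add: sn_scale mult_left_mono upper)
  have scale: "?U (free_scale c x) = cmod c * ?U x" for c x
  proof (cases "c = 0")
    case True
    then show ?thesis using scale_le[of c x] nonneg[of "free_scale c x"] by simp
  next
    case False
    have "?U x \<le> cmod (inverse c) * ?U (free_scale c x)"
      using scale_le[of "inverse c" "free_scale c x"] False by (simp add: free_scale_scale free_scale_one)
    then show ?thesis using scale_le[of c x] False by (simp add: norm_inverse norm_divide field_simps)
  qed
  have "?U (free_star x * x) \<le> (?U x)\<^sup>2" for x
    by (rule least) (simp add: sn_star_mult_self power_mono upper)
  moreover have "(?U x)\<^sup>2 \<le> ?U (free_star x * x)" for x
  proof -
    have "?U x \<le> sqrt (?U (free_star x * x))"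
    proof (rule least)
      fix N assume N: "?P N"
      then have "(N x)\<^sup>2 \<le> ?U (free_star x * x)"
        using upper[OF N, of "free_star x * x"] by (simp add: sn_star_mult_self)
      then show "N x \<le> sqrt (?U (free_star x * x))" by (rule real_le_rsqrt)
    qed
    then show ?thesis using nonneg[of x] nonneg[of "free_star x * x"]
      power_mono[of "?U x" "sqrt (?U (free_star x * x))" 2] by simp
  qed
  ultimately show ?thesis
    unfolding cstar_seminorm_def using add mult scale by (simp add: antisym)
qed


section \<open>The full semigroup C*-algebra\<close>

text \<open>The universal C*-algebra on isometries \<open>v\<^sub>p\<close> and projections \<open>e\<^sub>X\<close> subject to
  \<open>semigroup_relations\<close>, built from the free unital *-algebra; its universal property is proved at
  the end of the theory.\<close>

datatype ('a, 'x) generator = Isom 'a | Proj 'x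

type_synonym 'a semigroup_free_algebra = "('a, 'a cideal) generator free_star_algebra"

definition gen_v :: "'a::left_cancel_monoid \<Rightarrow> 'a semigroup_free_algebra" where
  "gen_v p = free_gen (Isom p)"

definition gen_e :: "'a::left_cancel_monoid cideal \<Rightarrow> 'a semigroup_free_algebra" where
  "gen_e X = free_gen (Proj X)"

inductive_set relators :: "'a::left_cancel_monoid semigroup_free_algebra set" where
  isom: "free_star (gen_v p) * gen_v p - 1 \<in> relators"
| proj_star: "free_star (gen_e X) - gen_e X \<in> relators"
| proj_idem: "gen_e X * gen_e X - gen_e X \<in> relators"
| mult: "gen_v p * gen_v q - gen_v (p * q) \<in> relators"
| translate: "gen_v p * gen_e X * free_star (gen_v p) - gen_e (cideal_mult p X) \<in> relators"
| zero: "gen_e cideal_empty \<in> relators"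
| one: "gen_e cideal_whole - 1 \<in> relators"
| inter: "gen_e X * gen_e Y - gen_e (cideal_inter X Y) \<in> relators"

abbreviation full_seminorm :: "'a::left_cancel_monoid semigroup_free_algebra \<Rightarrow> real" where
  "full_seminorm \<equiv> universal_seminorm relators"

lemma relators_gen_bound:
  fixes N :: "'a::left_cancel_monoid semigroup_free_algebra \<Rightarrow> real"
  assumes N: "cstar_seminorm N" and R: "\<forall>r\<in>relators. N r = 0"
  shows "N (free_gen g) \<le> 1"
proof (cases g)
  case (Isom p)
  have "(N (gen_v p))\<^sup>2 = N ((free_star (gen_v p) * gen_v p - 1) + 1)"
    using sn_star_mult_self[OF N, of "gen_v p"] by simp
  also have "\<dots> \<le> N (free_star (gen_v p) * gen_v p - 1) + N 1" by (rule sn_add[OF N])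
  also have "\<dots> \<le> 1" using R relators.isom[of p] sn_one_le[OF N] by simp
  finally show ?thesis using Isom by (simp add: gen_v_def power_le_one_iff sn_nonneg[OF N])
next
  case (Proj X)
  let ?e = "gen_e X"
  have eq: "free_star ?e * ?e = (free_star ?e - ?e) * ?e + ((?e * ?e - ?e) + ?e)"
    by (simp add: algebra_simps)
  have "(N ?e)\<^sup>2 = N (free_star ?e * ?e)" by (simp add: sn_star_mult_self[OF N])
  also have "\<dots> \<le> N ((free_star ?e - ?e) * ?e) + N ((?e * ?e - ?e) + ?e)"
    unfolding eq by (rule sn_add[OF N])
  also have "\<dots> \<le> N (free_star ?e - ?e) * N ?e + (N (?e * ?e - ?e) + N ?e)"
    by (intro add_mono sn_mult[OF N] sn_add[OF N])
  also have "\<dots> = N ?e" using R relators.proj_star[of X] relators.proj_idem[of X] by simp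
  finally have "N ?e \<le> 1"
    by (metis linorder_not_le mult_cancel_left1 mult_le_cancel_left_pos nle_le order.strict_trans
        order_less_irrefl power2_eq_square zero_less_one)
  then show ?thesis using Proj by (simp add: gen_e_def)
qed

lemma cstar_seminorm_le_coeffs:
  fixes N :: "'g free_star_algebra \<Rightarrow> real"
  assumes N: "cstar_seminorm N" and gen: "\<And>g. N (free_gen g) \<le> 1"
  shows "N x \<le> (\<Sum>w\<in>Poly_Mapping.keys x. cmod (Poly_Mapping.lookup x w))"
proof -
  have letter: "N (Poly_Mapping.single (Word [a]) 1) \<le> 1" for a
  proof (cases a)
    case (Gen g) then show ?thesis using gen[of g] by (simp add: free_gen_def)
  next
    case (Adj g)
    have "Poly_Mapping.single (Word [Adj g]) 1 = free_star (free_gen g)"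
      by (simp add: free_gen_def free_star_single word_star_def)
    then show ?thesis using gen[of g] sn_star[OF N, of "free_gen g"] Adj by simp
  qed
  have word: "N (Poly_Mapping.single (Word l) 1) \<le> 1" for l
  proof (induction l)
    case Nil
    then show ?case using sn_one_le[OF N] by (simp add: zero_star_word_def[symmetric])
  next
    case (Cons a l)
    have "Poly_Mapping.single (Word (a # l)) (1::complex) =
        Poly_Mapping.single (Word [a]) 1 * Poly_Mapping.single (Word l) 1"
      by (simp add: mult_single plus_star_word_def)
    then show ?case
      using sn_mult[OF N, of "Poly_Mapping.single (Word [a]) 1" "Poly_Mapping.single (Word l) 1"]
        mult_mono[OF letter[of a] Cons] sn_nonneg[OF N] by (simp add: order_trans)
  qed
  show ?thesis
  proof (induction x rule: update_induct)
    case const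
    then show ?case by (simp add: sn_zero[OF N])
  next
    case (update f a b)
    have eq: "Poly_Mapping.update a b f = free_scale b (Poly_Mapping.single a 1) + f"
      using update(1) by (intro poly_mapping_eqI)
        (auto simp: free_scale_single lookup_update lookup_add lookup_single when_def in_keys_iff)
    have "N (Poly_Mapping.update a b f) \<le> cmod b * N (Poly_Mapping.single a 1) + N f"
      unfolding eq using sn_add[OF N] sn_scale[OF N] by metis
    also have "\<dots> \<le> cmod b + N f"
      using mult_left_mono[OF word[of "letters a"], of "cmod b"] by simp
    also have "\<dots> \<le> cmod b + (\<Sum>w\<in>Poly_Mapping.keys f. cmod (Poly_Mapping.lookup f w))"
      using update by simp
    also have "\<dots> = (\<Sum>w\<in>Poly_Mapping.keys (Poly_Mapping.update a b f).
        cmod (Poly_Mapping.lookup (Poly_Mapping.update a b f) w))"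
    proof -
      have "(\<Sum>w\<in>Poly_Mapping.keys f. cmod (Poly_Mapping.lookup f w)) =
          (\<Sum>w\<in>Poly_Mapping.keys f. cmod (Poly_Mapping.lookup (Poly_Mapping.update a b f) w))"
        using update(1) by (intro sum.cong) (auto simp: lookup_update)
      then show ?thesis using update(1,2) by (simp add: keys_update lookup_update)
    qed
    finally show ?case .
  qed
qed

lemma bdd_full_seminorm:
  "bdd_above {N x |N. cstar_seminorm N \<and> (\<forall>r\<in>(relators :: 'a::left_cancel_monoid semigroup_free_algebra set). N r = 0)}"
  by (rule bdd_aboveI[where M = "\<Sum>w\<in>Poly_Mapping.keys x. cmod (Poly_Mapping.lookup x w)"])
    (auto intro!: cstar_seminorm_le_coeffs relators_gen_bound)

lemma cstar_seminorm_full: "cstar_seminorm full_seminorm"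
  by (rule cstar_seminorm_universal) (rule bdd_full_seminorm)

lemma le_full_seminorm:
  assumes "cstar_seminorm N" "\<And>r. r \<in> relators \<Longrightarrow> N r = 0"
  shows "N x \<le> full_seminorm x"
  unfolding universal_seminorm_def by (rule cSup_upper[OF _ bdd_full_seminorm]) (use assms in blast)

lemma full_seminorm_relator: "r \<in> relators \<Longrightarrow> full_seminorm r = 0"
  unfolding universal_seminorm_def using cstar_seminorm_zero
  by (intro cSup_eq_maximum) auto

quotient_type (overloaded) 'a full_cstar = "nat \<Rightarrow> 'a::left_cancel_monoid semigroup_free_algebra" /
  partial: "completion_rel full_seminorm"
  by (rule part_equivp_completion_rel[OF cstar_seminorm_full])

lemmas full_rel = completion_rel_add[OF cstar_seminorm_full] completion_rel_uminus[OF cstar_seminorm_full]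
  completion_rel_diff[OF cstar_seminorm_full] completion_rel_scale[OF cstar_seminorm_full]
  completion_rel_star[OF cstar_seminorm_full] completion_rel_mult[OF cstar_seminorm_full]

lemma full_rel_const: "completion_rel full_seminorm (\<lambda>n. x) (\<lambda>n. x)"
  by (simp add: completion_rel_refl_iff[OF cstar_seminorm_full] sn_Cauchy_const[OF cstar_seminorm_full])

lemma full_seminorm_lim:
  assumes "completion_rel full_seminorm X X"
  shows "(\<lambda>n. full_seminorm (X n)) \<longlonglongrightarrow> lim (\<lambda>n. full_seminorm (X n))"
  using sn_Cauchy_convergent[OF cstar_seminorm_full] assms
  by (simp add: completion_rel_refl_iff[OF cstar_seminorm_full] convergent_LIMSEQ_iff)

instantiation full_cstar :: (left_cancel_monoid) "{minus, uminus, zero, plus, one, times}"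
begin
lift_definition zero_full_cstar :: "'a full_cstar" is "\<lambda>n. 0" by (rule full_rel_const)
lift_definition one_full_cstar :: "'a full_cstar" is "\<lambda>n. 1" by (rule full_rel_const)
lift_definition plus_full_cstar :: "'a full_cstar \<Rightarrow> 'a full_cstar \<Rightarrow> 'a full_cstar"
  is "\<lambda>X Y n. X n + Y n" by (rule full_rel)
lift_definition uminus_full_cstar :: "'a full_cstar \<Rightarrow> 'a full_cstar"
  is "\<lambda>X n. - X n" by (rule full_rel)
lift_definition minus_full_cstar :: "'a full_cstar \<Rightarrow> 'a full_cstar \<Rightarrow> 'a full_cstar"
  is "\<lambda>X Y n. X n - Y n" by (rule full_rel)
lift_definition times_full_cstar :: "'a full_cstar \<Rightarrow> 'a full_cstar \<Rightarrow> 'a full_cstar"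
  is "\<lambda>X Y n. X n * Y n" by (rule full_rel)
instance ..
end

lift_definition full_norm :: "'a::left_cancel_monoid full_cstar \<Rightarrow> real"
  is "\<lambda>X. lim (\<lambda>n. full_seminorm (X n))" by (rule completion_rel_lim[OF cstar_seminorm_full])
lift_definition full_scaleC :: "complex \<Rightarrow> 'a::left_cancel_monoid full_cstar \<Rightarrow> 'a full_cstar"
  is "\<lambda>c X n. free_scale c (X n)" by (rule full_rel)
lift_definition full_star :: "'a::left_cancel_monoid full_cstar \<Rightarrow> 'a full_cstar"
  is "\<lambda>X n. free_star (X n)" by (rule full_rel)
definition full_embed :: "'a::left_cancel_monoid semigroup_free_algebra \<Rightarrow> 'a full_cstar" where
  "full_embed x = abs_full_cstar (\<lambda>n. x)"

instance full_cstar :: (left_cancel_monoid) "{ring, monoid_mult}"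
proof
  fix a b c :: "'a full_cstar"
  show "a + b + c = a + (b + c)" by transfer (simp add: add.assoc full_rel)
  show "a + b = b + a" by transfer (simp add: add.commute full_rel)
  show "0 + a = a" by transfer simp
  show "- a + a = 0" by transfer (simp add: full_rel_const)
  show "a - b = a + - b" by transfer (simp add: full_rel)
  show "a * b * c = a * (b * c)" by transfer (simp add: mult.assoc full_rel)
  show "(a + b) * c = a * c + b * c" by transfer (simp add: distrib_right full_rel)
  show "a * (b + c) = a * b + a * c" by transfer (simp add: distrib_left full_rel)
  show "1 * a = a" by transfer simp
  show "a * 1 = a" by transfer simp
qed

lemma full_scaleC_one: "full_scaleC 1 a = a"
  by transfer (simp add: free_scale_one)

lemma full_norm_embed: "full_norm (full_embed x) = full_seminorm x"
  by (simp add: full_embed_def full_norm.abs_eq full_rel_const)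

lemma full_norm_scaleC: "full_norm (full_scaleC c a) = cmod c * full_norm a"
proof transfer
  fix c and X :: "nat \<Rightarrow> 'a semigroup_free_algebra"
  assume "completion_rel full_seminorm X X"
  from tendsto_mult[OF tendsto_const full_seminorm_lim[OF this]]
  show "lim (\<lambda>n. full_seminorm (free_scale c (X n))) = cmod c * lim (\<lambda>n. full_seminorm (X n))"
    by (intro limI) (simp add: sn_scale[OF cstar_seminorm_full])
qed

lemma full_norm_triangle: "full_norm (a + b) \<le> full_norm a + full_norm (b :: 'a::left_cancel_monoid full_cstar)"
proof transfer
  fix X Y :: "nat \<Rightarrow> 'a semigroup_free_algebra"
  assume *: "completion_rel full_seminorm X X" "completion_rel full_seminorm Y Y"
  show "lim (\<lambda>n. full_seminorm (X n + Y n)) \<le> lim (\<lambda>n. full_seminorm (X n)) + lim (\<lambda>n. full_seminorm (Y n))"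
    by (rule LIMSEQ_le[OF full_seminorm_lim[OF full_rel(1)[OF *]]
          tendsto_add[OF full_seminorm_lim[OF *(1)] full_seminorm_lim[OF *(2)]]])
      (auto intro: sn_add[OF cstar_seminorm_full])
qed

lemma full_norm_mult: "full_norm (a * b) \<le> full_norm a * full_norm (b :: 'a::left_cancel_monoid full_cstar)"
proof transfer
  fix X Y :: "nat \<Rightarrow> 'a semigroup_free_algebra"
  assume *: "completion_rel full_seminorm X X" "completion_rel full_seminorm Y Y"
  show "lim (\<lambda>n. full_seminorm (X n * Y n)) \<le> lim (\<lambda>n. full_seminorm (X n)) * lim (\<lambda>n. full_seminorm (Y n))"
    by (rule LIMSEQ_le[OF full_seminorm_lim[OF full_rel(6)[OF *]]
          tendsto_mult[OF full_seminorm_lim[OF *(1)] full_seminorm_lim[OF *(2)]]])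
      (auto intro: sn_mult[OF cstar_seminorm_full])
qed

lemma full_norm_star_mult_self: "full_norm (full_star a * a) = (full_norm a)\<^sup>2"
proof transfer
  fix X :: "nat \<Rightarrow> 'a semigroup_free_algebra"
  assume "completion_rel full_seminorm X X"
  from tendsto_power[OF full_seminorm_lim[OF this], of 2]
  show "lim (\<lambda>n. full_seminorm (free_star (X n) * X n)) = (lim (\<lambda>n. full_seminorm (X n)))\<^sup>2"
    by (intro limI) (simp add: sn_star_mult_self[OF cstar_seminorm_full])
qed

lemma full_norm_eq_zero: "full_norm a = 0 \<longleftrightarrow> a = (0 :: 'a::left_cancel_monoid full_cstar)"
proof transfer
  fix X :: "nat \<Rightarrow> 'a semigroup_free_algebra"
  assume *: "completion_rel full_seminorm X X"
  show "lim (\<lambda>n. full_seminorm (X n)) = 0 \<longleftrightarrow> completion_rel full_seminorm X (\<lambda>n. 0)"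
  proof
    assume "lim (\<lambda>n. full_seminorm (X n)) = 0"
    then show "completion_rel full_seminorm X (\<lambda>n. 0)"
      using full_seminorm_lim[OF *] * sn_Cauchy_const[OF cstar_seminorm_full]
      by (simp add: completion_rel_def)
  next
    assume "completion_rel full_seminorm X (\<lambda>n. 0)"
    then show "lim (\<lambda>n. full_seminorm (X n)) = 0"
      by (simp add: completion_rel_def limI)
  qed
qed

instantiation full_cstar :: (left_cancel_monoid) real_normed_algebra
begin
definition scaleR_full_cstar :: "real \<Rightarrow> 'a full_cstar \<Rightarrow> 'a full_cstar" where
  "scaleR_full_cstar r a = full_scaleC (complex_of_real r) a"
definition norm_full_cstar :: "'a full_cstar \<Rightarrow> real" where
  "norm_full_cstar = full_norm"
definition dist_full_cstar :: "'a full_cstar \<Rightarrow> 'a full_cstar \<Rightarrow> real" where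
  "dist_full_cstar a b = norm (a - b)"
definition sgn_full_cstar :: "'a full_cstar \<Rightarrow> 'a full_cstar" where
  "sgn_full_cstar a = inverse (norm a) *\<^sub>R a"
definition uniformity_full_cstar :: "('a full_cstar \<times> 'a full_cstar) filter" where
  "uniformity_full_cstar = (INF e\<in>{0<..}. principal {(a, b). dist a b < e})"
definition open_full_cstar :: "'a full_cstar set \<Rightarrow> bool" where
  "open_full_cstar U \<longleftrightarrow> (\<forall>a\<in>U. eventually (\<lambda>(a', b). a' = a \<longrightarrow> b \<in> U) uniformity)"
instance
proof
  fix a b :: "'a full_cstar" and r s :: real and U :: "'a full_cstar set"
  show "r *\<^sub>R (a + b) = r *\<^sub>R a + r *\<^sub>R b"
    unfolding scaleR_full_cstar_def by transfer (simp add: free_scale_add_right full_rel)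
  show "(r + s) *\<^sub>R a = r *\<^sub>R a + s *\<^sub>R a"
    unfolding scaleR_full_cstar_def of_real_add by transfer (simp add: free_scale_add_left full_rel)
  show "r *\<^sub>R s *\<^sub>R a = (r * s) *\<^sub>R a"
    unfolding scaleR_full_cstar_def of_real_mult by transfer (simp add: free_scale_scale full_rel)
  show "1 *\<^sub>R a = a" by (simp add: scaleR_full_cstar_def full_scaleC_one)
  show "r *\<^sub>R a * b = r *\<^sub>R (a * b)"
    unfolding scaleR_full_cstar_def by transfer (simp add: free_scale_mult_left full_rel)
  show "a * r *\<^sub>R b = r *\<^sub>R (a * b)"
    unfolding scaleR_full_cstar_def by transfer (simp add: free_scale_mult_right full_rel)
  show "norm (r *\<^sub>R a) = \<bar>r\<bar> * norm a"
    by (simp add: norm_full_cstar_def scaleR_full_cstar_def full_norm_scaleC)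
  show "dist a b = norm (a - b)" by (rule dist_full_cstar_def)
  show "sgn a = inverse (norm a) *\<^sub>R a" by (rule sgn_full_cstar_def)
  show "uniformity = (INF e\<in>{0<..}. principal {(a, b). dist a (b :: 'a full_cstar) < e})"
    by (rule uniformity_full_cstar_def)
  show "open U \<longleftrightarrow> (\<forall>a\<in>U. \<forall>\<^sub>F (a', b) in uniformity. a' = a \<longrightarrow> b \<in> U)"
    by (rule open_full_cstar_def)
  show "norm a = 0 \<longleftrightarrow> a = 0" unfolding norm_full_cstar_def by (rule full_norm_eq_zero)
  show "norm (a + b) \<le> norm a + norm b" unfolding norm_full_cstar_def by (rule full_norm_triangle)
  show "norm (a * b) \<le> norm a * norm b" unfolding norm_full_cstar_def by (rule full_norm_mult)
qed
end

lemma norm_full_embed: "norm (full_embed x) = full_seminorm x"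
  by (simp add: norm_full_cstar_def full_norm_embed)

lemma full_embed_diff: "full_embed (x - y) = full_embed x - full_embed y"
  by (simp add: full_embed_def minus_full_cstar.abs_eq full_rel_const)

lemma full_embed_tendsto:
  assumes X: "seminorm_Cauchy full_seminorm X"
  shows "(\<lambda>m. full_embed (X m)) \<longlonglongrightarrow> abs_full_cstar X"
proof (rule metric_LIMSEQ_I)
  fix e :: real assume "e > 0"
  then obtain M where M: "\<forall>m\<ge>M. \<forall>n\<ge>M. full_seminorm (X m - X n) < e / 2"
    using X by (force simp: seminorm_Cauchy_def dest: spec[of _ "e / 2"])
  have "dist (full_embed (X m)) (abs_full_cstar X) < e" if "m \<ge> M" for m
  proof -
    have XX: "completion_rel full_seminorm X X"
      using X by (simp add: completion_rel_refl_iff[OF cstar_seminorm_full])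
    have "full_embed (X m) - abs_full_cstar X = abs_full_cstar (\<lambda>n. X m - X n)"
      by (simp add: full_embed_def minus_full_cstar.abs_eq full_rel_const XX)
    then have eq: "norm (full_embed (X m) - abs_full_cstar X) = lim (\<lambda>n. full_seminorm (X m - X n))"
      by (simp add: norm_full_cstar_def full_norm.abs_eq full_rel full_rel_const XX)
    have "lim (\<lambda>n. full_seminorm (X m - X n)) \<le> e / 2"
      by (rule LIMSEQ_le_const2[OF full_seminorm_lim[OF full_rel(3)[OF full_rel_const XX]]])
        (use M that in force)
    then show ?thesis using eq \<open>e > 0\<close> by (simp add: dist_norm)
  qed
  then show "\<exists>M. \<forall>m\<ge>M. dist (full_embed (X m)) (abs_full_cstar X) < e" by blast
qed

lemma full_cstar_cases:
  obtains X where "seminorm_Cauchy full_seminorm X" "a = abs_full_cstar X"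
  by (metis Quotient3_abs_rep Quotient3_full_cstar Quotient3_rep_reflp cstar_seminorm_full
      completion_rel_refl_iff)

lemma full_embed_dense:
  assumes "e > 0" shows "\<exists>x. dist a (full_embed x) < e"
proof -
  obtain X where X: "seminorm_Cauchy full_seminorm X" "a = abs_full_cstar X" by (rule full_cstar_cases)
  then show ?thesis using metric_LIMSEQ_D[OF full_embed_tendsto[OF X(1)] assms]
    by (metis dist_commute order_refl)
qed

instance full_cstar :: (left_cancel_monoid) banach
proof
  fix A :: "nat \<Rightarrow> 'a full_cstar" assume A: "Cauchy A"
  have "\<exists>x. dist (A n) (full_embed x) < inverse (real (Suc n))" for n
    by (rule full_embed_dense) simp
  then obtain X where X: "\<And>n. dist (A n) (full_embed (X n)) < inverse (real (Suc n))" by metis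
  have "norm (full_embed (X n) - A n) \<le> inverse (real (Suc n))" for n
    using X[of n] by (metis dist_commute dist_norm less_imp_le)
  then have lim0: "(\<lambda>n. full_embed (X n) - A n) \<longlonglongrightarrow> 0"
    by (intro Lim_null_comparison[OF always_eventually LIMSEQ_inverse_real_of_nat] allI)
  have "seminorm_Cauchy full_seminorm X"
    unfolding seminorm_Cauchy_def
  proof (intro allI impI)
    fix e :: real assume "e > 0"
    then have e3: "e / 3 > 0" by simp
    obtain M1 where M1: "\<And>n. n \<ge> M1 \<Longrightarrow> norm (full_embed (X n) - A n) < e / 3"
      using LIMSEQ_D[OF lim0 e3] by auto
    obtain M2 where M2: "\<And>m n. m \<ge> M2 \<Longrightarrow> n \<ge> M2 \<Longrightarrow> norm (A m - A n) < e / 3"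
      using CauchyD[OF A e3] by blast
    have "full_seminorm (X m - X n) < e" if "m \<ge> max M1 M2" "n \<ge> max M1 M2" for m n
    proof -
      have "full_embed (X m - X n) =
          (full_embed (X m) - A m) + (A m - A n) - (full_embed (X n) - A n)"
        by (simp add: full_embed_diff)
      from arg_cong[OF this, of norm] have "full_seminorm (X m - X n) \<le>
          norm (full_embed (X m) - A m) + norm (A m - A n) + norm (full_embed (X n) - A n)"
        using norm_triangle_ineq4[of "(full_embed (X m) - A m) + (A m - A n)" "full_embed (X n) - A n"]
          norm_triangle_ineq[of "full_embed (X m) - A m" "A m - A n"] norm_full_embed[of "X m - X n"]
        by linarith
      then show ?thesis using M1[of m] M1[of n] M2[of m n] that by simp
    qed
    then show "\<exists>M. \<forall>m\<ge>M. \<forall>n\<ge>M. full_seminorm (X m - X n) < e" by blast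
  qed
  from tendsto_diff[OF full_embed_tendsto[OF this] lim0]
  show "convergent A" by (auto simp: convergent_def)
qed

instantiation full_cstar :: (left_cancel_monoid) cstar_algebra
begin
definition scaleC_full_cstar :: "complex \<Rightarrow> 'a full_cstar \<Rightarrow> 'a full_cstar" where
  "scaleC_full_cstar = full_scaleC"
definition star_full_cstar :: "'a full_cstar \<Rightarrow> 'a full_cstar" where
  "star_full_cstar = full_star"
instance
proof
  fix a b :: "'a full_cstar" and c d :: complex and r :: real
  show "c *\<^sub>C (a + b) = c *\<^sub>C a + c *\<^sub>C b"
    unfolding scaleC_full_cstar_def by transfer (simp add: free_scale_add_right full_rel)
  show "(c + d) *\<^sub>C a = c *\<^sub>C a + d *\<^sub>C a"
    unfolding scaleC_full_cstar_def by transfer (simp add: free_scale_add_left full_rel)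
  show "c *\<^sub>C d *\<^sub>C a = (c * d) *\<^sub>C a"
    unfolding scaleC_full_cstar_def by transfer (simp add: free_scale_scale full_rel)
  show "r *\<^sub>R a = complex_of_real r *\<^sub>C a"
    by (simp add: scaleC_full_cstar_def scaleR_full_cstar_def)
  show "c *\<^sub>C a * b = c *\<^sub>C (a * b)"
    unfolding scaleC_full_cstar_def by transfer (simp add: free_scale_mult_left full_rel)
  show "a * c *\<^sub>C b = c *\<^sub>C (a * b)"
    unfolding scaleC_full_cstar_def by transfer (simp add: free_scale_mult_right full_rel)
  show "norm (c *\<^sub>C a) = norm c * norm a"
    by (simp add: norm_full_cstar_def scaleC_full_cstar_def full_norm_scaleC)
  show "star (star a) = a"
    unfolding star_full_cstar_def by transfer (simp add: free_star_star)
  show "star (a + b) = star a + star b"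
    unfolding star_full_cstar_def by transfer (simp add: free_star_add full_rel)
  show "star (c *\<^sub>C a) = cnj c *\<^sub>C star a"
    unfolding star_full_cstar_def scaleC_full_cstar_def by transfer (simp add: free_star_scale full_rel)
  show "star (a * b) = star b * star a"
    unfolding star_full_cstar_def by transfer (simp add: free_star_mult full_rel)
  show "norm (star a * a) = (norm a)\<^sup>2"
    by (simp add: norm_full_cstar_def star_full_cstar_def full_norm_star_mult_self)
qed
end

definition full_isometry :: "'a::left_cancel_monoid \<Rightarrow> 'a full_cstar" where
  "full_isometry p = full_embed (gen_v p)"

definition full_projection :: "'a::left_cancel_monoid cideal \<Rightarrow> 'a full_cstar" where
  "full_projection X = full_embed (gen_e X)"

text \<open>The construction has the universal property: the canonical generators satisfy the relations,
  every family satisfying them in some unital C*-algebra (of arbitrary type) is the image of the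
  canonical one under a *-homomorphism, and a continuous *-homomorphism is determined by the values
  on the generators.\<close>

lemma full_embed_add: "full_embed (x + y) = full_embed x + full_embed y"
  by (simp add: full_embed_def plus_full_cstar.abs_eq full_rel_const)

lemma full_embed_mult: "full_embed (x * y) = full_embed x * full_embed y"
  by (simp add: full_embed_def times_full_cstar.abs_eq full_rel_const)

lemma full_embed_scale: "full_embed (free_scale c x) = c *\<^sub>C full_embed x"
  by (simp add: full_embed_def scaleC_full_cstar_def full_scaleC.abs_eq full_rel_const)

lemma full_embed_star: "full_embed (free_star x) = star (full_embed x)"
  by (simp add: full_embed_def star_full_cstar_def full_star.abs_eq full_rel_const)

lemma full_embed_zero: "full_embed 0 = 0"
  by (simp add: full_embed_def zero_full_cstar_def)

lemma full_embed_one: "full_embed 1 = 1"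
  by (simp add: full_embed_def one_full_cstar_def)

lemma full_embed_relator: "x - y \<in> relators \<Longrightarrow> full_embed x = full_embed y"
  using norm_full_embed[of "x - y"] by (simp add: full_embed_diff full_seminorm_relator)

theorem full_cstar_relations: "semigroup_relations full_isometry full_projection"
proof -
  have "full_embed (gen_e cideal_empty) = (0 :: 'a full_cstar)"
    using norm_full_embed[of "gen_e cideal_empty :: 'a semigroup_free_algebra"]
    by (simp add: full_seminorm_relator relators.zero)
  then show ?thesis
    unfolding semigroup_relations_def is_isometry_def is_projection_def
      full_isometry_def full_projection_def
      full_embed_star[symmetric] full_embed_mult[symmetric] full_embed_one[symmetric]
    by (auto intro!: full_embed_relator relators.intros)
qed

lemma cstar_scaleC_one: "1 *\<^sub>C x = (x :: 'a::cstar_algebra)"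
  using scaleR_scaleC[of 1 x] by simp

lemma cstar_scaleC_zero: "0 *\<^sub>C x = (0 :: 'a::cstar_algebra)"
  using scaleR_scaleC[of 0 x] by simp

lemma cstar_star_one: "star 1 = (1 :: 'a::cstar_algebra)"
  by (metis mult_1_left mult_1_right star_mult star_star)

lemma cstar_star_zero: "star 0 = (0 :: 'a::cstar_algebra)"
  using star_add[of 0 "0::'a"] by simp

lemma cstar_norm_star: "norm (star x) = norm (x :: 'a::cstar_algebra)"
proof -
  have le: "norm x \<le> norm (star x)" for x :: 'a
    using norm_star_mult_self[of x] norm_mult_ineq[of "star x" x]
    by (cases "x = 0") (auto simp: power2_eq_square)
  show ?thesis using le[of x] le[of "star x"] by (simp add: star_star)
qed

fun letter_eval :: "('g \<Rightarrow> 'b::cstar_algebra) \<Rightarrow> 'g letter \<Rightarrow> 'b" where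
  "letter_eval \<gamma> (Gen g) = \<gamma> g"
| "letter_eval \<gamma> (Adj g) = star (\<gamma> g)"

definition word_eval :: "('g \<Rightarrow> 'b::cstar_algebra) \<Rightarrow> 'g star_word \<Rightarrow> 'b" where
  "word_eval \<gamma> w = prod_list (map (letter_eval \<gamma>) (letters w))"

definition free_eval :: "('g \<Rightarrow> 'b::cstar_algebra) \<Rightarrow> 'g free_star_algebra \<Rightarrow> 'b" where
  "free_eval \<gamma> x = (\<Sum>w\<in>Poly_Mapping.keys x. Poly_Mapping.lookup x w *\<^sub>C word_eval \<gamma> w)"

lemma word_eval_add: "word_eval \<gamma> (v + w) = word_eval \<gamma> v * word_eval \<gamma> w"
  by (simp add: word_eval_def plus_star_word_def)

lemma word_eval_star: "word_eval \<gamma> (word_star w) = star (word_eval \<gamma> w)"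
proof -
  have letter: "letter_eval \<gamma> (letter_star a) = star (letter_eval \<gamma> a)" for a
    by (cases a) (auto simp: star_star)
  have "prod_list (map (letter_eval \<gamma>) (rev (map letter_star l))) =
      star (prod_list (map (letter_eval \<gamma>) l))" for l
    by (induction l) (simp_all add: letter cstar_star_one star_mult)
  then show ?thesis by (simp add: word_eval_def word_star_def)
qed

lemma free_eval_superset:
  assumes "finite A" "Poly_Mapping.keys x \<subseteq> A"
  shows "free_eval \<gamma> x = (\<Sum>w\<in>A. Poly_Mapping.lookup x w *\<^sub>C word_eval \<gamma> w)"
  unfolding free_eval_def
  by (rule sum.mono_neutral_left) (use assms in \<open>auto simp: in_keys_iff cstar_scaleC_zero\<close>)

lemma free_eval_zero: "free_eval \<gamma> 0 = 0"
  by (simp add: free_eval_def)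

lemma free_eval_single: "free_eval \<gamma> (Poly_Mapping.single w c) = c *\<^sub>C word_eval \<gamma> w"
  by (simp add: free_eval_def cstar_scaleC_zero)

lemma free_eval_add: "free_eval \<gamma> (x + y) = free_eval \<gamma> x + free_eval \<gamma> y"
proof -
  let ?A = "Poly_Mapping.keys x \<union> Poly_Mapping.keys y"
  have "free_eval \<gamma> (x + y) = (\<Sum>w\<in>?A. Poly_Mapping.lookup (x + y) w *\<^sub>C word_eval \<gamma> w)"
    by (rule free_eval_superset) (use Poly_Mapping.keys_add[of x y] in auto)
  also have "\<dots> = (\<Sum>w\<in>?A. Poly_Mapping.lookup x w *\<^sub>C word_eval \<gamma> w) +
      (\<Sum>w\<in>?A. Poly_Mapping.lookup y w *\<^sub>C word_eval \<gamma> w)"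
    by (simp add: lookup_add scaleC_add_left sum.distrib)
  also have "\<dots> = free_eval \<gamma> x + free_eval \<gamma> y"
    using free_eval_superset[of ?A x \<gamma>] free_eval_superset[of ?A y \<gamma>] by simp
  finally show ?thesis .
qed

lemma free_eval_mult: "free_eval \<gamma> (x * y) = free_eval \<gamma> x * free_eval \<gamma> y"
proof (induction x rule: poly_mapping_add_induct)
  case (single v c)
  show ?case
  proof (induction y rule: poly_mapping_add_induct)
    case (single w d)
    show ?case
      by (simp add: mult_single free_eval_single word_eval_add scaleC_mult_left scaleC_mult_right
          scaleC_scaleC mult.commute[of c d])
  qed (simp_all add: free_eval_zero free_eval_add distrib_left)
qed (simp_all add: free_eval_zero free_eval_add distrib_right)

lemma free_eval_scale: "free_eval \<gamma> (free_scale c x) = c *\<^sub>C free_eval \<gamma> x"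
proof -
  have "free_eval \<gamma> (free_scale c x) = (c *\<^sub>C word_eval \<gamma> 0) * free_eval \<gamma> x"
    by (simp only: free_scale_conv_mult free_eval_mult free_eval_single)
  then show ?thesis by (simp add: word_eval_def zero_star_word_def scaleC_mult_left)
qed

lemma free_eval_diff: "free_eval \<gamma> (x - y) = free_eval \<gamma> x - free_eval \<gamma> y"
  using free_eval_add[of \<gamma> "x - y" y] by simp

lemma free_eval_star: "free_eval \<gamma> (free_star x) = star (free_eval \<gamma> x)"
  by (induction x rule: poly_mapping_add_induct)
    (simp_all add: free_star_zero free_star_add free_star_single free_eval_zero free_eval_add
      free_eval_single cstar_star_zero star_add star_scaleC word_eval_star)

lemma free_eval_one: "free_eval \<gamma> 1 = 1"
  unfolding single_one[symmetric] free_eval_single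
  by (simp add: word_eval_def zero_star_word_def cstar_scaleC_one)

lemma free_eval_gen: "free_eval \<gamma> (free_gen g) = \<gamma> g"
  by (simp add: free_gen_def free_eval_single word_eval_def cstar_scaleC_one)

lemma cstar_seminorm_free_eval: "cstar_seminorm (\<lambda>x. norm (free_eval \<gamma> x))"
  unfolding cstar_seminorm_def
  by (simp add: free_eval_add free_eval_mult free_eval_scale free_eval_star norm_scaleC
      norm_star_mult_self norm_triangle_ineq norm_mult_ineq)

theorem full_cstar_universal:
  fixes v :: "'a::left_cancel_monoid \<Rightarrow> 'b::cstar_algebra"
  assumes ve: "semigroup_relations v e"
  obtains F :: "'a full_cstar \<Rightarrow> 'b" where
    "star_homomorphism F" "\<And>x. norm (F x) \<le> norm x"
    "\<And>p. F (full_isometry p) = v p" "\<And>X. F (full_projection X) = e X"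
proof -
  define \<pi> where "\<pi> = free_eval (case_generator v e)"
  have gens: "\<pi> (gen_v p) = v p" "\<pi> (gen_e X) = e X" for p X
    by (simp_all add: \<pi>_def gen_v_def gen_e_def free_eval_gen)
  have rel: "\<pi> r = 0" if "r \<in> relators" for r
    using that
  proof cases
  qed (use ve in \<open>simp_all add: \<pi>_def[symmetric] gens semigroup_relations_def is_isometry_def is_projection_def
      free_eval_diff[of "case_generator v e", folded \<pi>_def] free_eval_mult[of "case_generator v e", folded \<pi>_def]
      free_eval_star[of "case_generator v e", folded \<pi>_def] free_eval_one[of "case_generator v e", folded \<pi>_def]\<close>)
  have bound: "norm (\<pi> x) \<le> full_seminorm x" for x
    unfolding \<pi>_def
    by (rule le_full_seminorm[OF cstar_seminorm_free_eval]) (simp add: rel[unfolded \<pi>_def])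
  have conv: "convergent (\<lambda>n. \<pi> (X n))" if "seminorm_Cauchy full_seminorm X" for X
  proof -
    have "norm (\<pi> (X m) - \<pi> (X n)) \<le> full_seminorm (X m - X n)" for m n
      using bound[of "X m - X n"] by (simp add: \<pi>_def free_eval_diff)
    then have "Cauchy (\<lambda>n. \<pi> (X n))"
      using that unfolding Cauchy_def seminorm_Cauchy_def dist_norm by (meson order_le_less_trans)
    then show ?thesis by (simp add: Cauchy_convergent_iff)
  qed
  define F where "F a = lim (\<lambda>n. \<pi> (rep_full_cstar a n))" for a
  have F: "(\<lambda>n. \<pi> (X n)) \<longlonglongrightarrow> F (abs_full_cstar X)" if X: "seminorm_Cauchy full_seminorm X" for X
  proof -
    let ?Y = "rep_full_cstar (abs_full_cstar X)"
    have "completion_rel full_seminorm ?Y X"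
      using X by (intro rep_abs_rsp_left[OF Quotient3_full_cstar])
        (simp add: completion_rel_refl_iff[OF cstar_seminorm_full])
    then have Y: "seminorm_Cauchy full_seminorm ?Y" and lim: "(\<lambda>n. full_seminorm (?Y n - X n)) \<longlonglongrightarrow> 0"
      by (auto simp: completion_rel_def)
    have "(\<lambda>n. \<pi> (?Y n) - \<pi> (X n)) \<longlonglongrightarrow> 0"
    proof (rule Lim_null_comparison[OF always_eventually lim], rule allI)
      show "norm (\<pi> (?Y n) - \<pi> (X n)) \<le> full_seminorm (?Y n - X n)" for n
        using bound[of "?Y n - X n"] by (simp add: \<pi>_def free_eval_diff)
    qed
    moreover have "(\<lambda>n. \<pi> (?Y n)) \<longlonglongrightarrow> F (abs_full_cstar X)"
      unfolding F_def using conv[OF Y] by (simp add: convergent_LIMSEQ_iff)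
    ultimately show ?thesis
      using tendsto_diff[of "\<lambda>n. \<pi> (?Y n)" "F (abs_full_cstar X)" sequentially "\<lambda>n. \<pi> (?Y n) - \<pi> (X n)" 0]
      by simp
  qed
  have embed: "F (full_embed x) = \<pi> x" for x
    using LIMSEQ_unique[OF F[OF sn_Cauchy_const[OF cstar_seminorm_full]] tendsto_const]
    by (simp add: full_embed_def)
  have bound': "norm (F a) \<le> norm a" for a
  proof -
    obtain X where X: "seminorm_Cauchy full_seminorm X" "a = abs_full_cstar X" by (rule full_cstar_cases)
    have "(\<lambda>n. full_seminorm (X n)) \<longlonglongrightarrow> norm a"
      using tendsto_norm[OF full_embed_tendsto[OF X(1)]] by (simp add: norm_full_embed X(2))
    then show ?thesis
      using tendsto_norm[OF F[OF X(1)]] by (intro LIMSEQ_le) (auto simp: X(2) bound)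
  qed
  have "F (a + b) = F a + F b \<and> F (a * b) = F a * F b" for a b
  proof -
    obtain X where X: "seminorm_Cauchy full_seminorm X" "a = abs_full_cstar X" by (rule full_cstar_cases)
    obtain Y where Y: "seminorm_Cauchy full_seminorm Y" "b = abs_full_cstar Y" by (rule full_cstar_cases)
    note refl = completion_rel_refl_iff[OF cstar_seminorm_full]
    have eq: "a + b = abs_full_cstar (\<lambda>n. X n + Y n)" "a * b = abs_full_cstar (\<lambda>n. X n * Y n)"
      using X Y by (simp_all add: plus_full_cstar.abs_eq times_full_cstar.abs_eq refl)
    have lim: "(\<lambda>n. \<pi> (X n + Y n)) \<longlonglongrightarrow> F a + F b" "(\<lambda>n. \<pi> (X n * Y n)) \<longlonglongrightarrow> F a * F b"
      using tendsto_add[OF F[OF X(1)] F[OF Y(1)]] tendsto_mult[OF F[OF X(1)] F[OF Y(1)]]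
      by (simp_all add: \<pi>_def free_eval_add free_eval_mult X(2) Y(2))
    show ?thesis
      using LIMSEQ_unique[OF F[OF sn_Cauchy_add[OF cstar_seminorm_full X(1) Y(1)]] lim(1)]
        LIMSEQ_unique[OF F[OF sn_Cauchy_mult[OF cstar_seminorm_full X(1) Y(1)]] lim(2)]
      unfolding eq by blast
  qed
  moreover have "F (c *\<^sub>C a) = c *\<^sub>C F a \<and> F (star a) = star (F a)" for c a
  proof -
    obtain X where X: "seminorm_Cauchy full_seminorm X" "a = abs_full_cstar X" by (rule full_cstar_cases)
    note refl = completion_rel_refl_iff[OF cstar_seminorm_full]
    have eq: "c *\<^sub>C a = abs_full_cstar (\<lambda>n. free_scale c (X n))" "star a = abs_full_cstar (\<lambda>n. free_star (X n))"
      using X by (simp_all add: scaleC_full_cstar_def star_full_cstar_def full_scaleC.abs_eq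
          full_star.abs_eq refl)
    have diff: "(\<lambda>n. norm (\<pi> (X n) - F a)) \<longlonglongrightarrow> 0"
      using F[OF X(1)] by (simp add: X(2) tendsto_norm_zero_iff LIM_zero_iff)
    have "norm (\<pi> (free_scale c (X n)) - c *\<^sub>C F a) = norm c * norm (\<pi> (X n) - F a)" for n
      using scaleC_add_right[of c "\<pi> (X n) - F a" "F a"] norm_scaleC[of c "\<pi> (X n) - F a"]
      by (simp add: \<pi>_def free_eval_scale)
    then have "(\<lambda>n. norm (\<pi> (free_scale c (X n)) - c *\<^sub>C F a)) \<longlonglongrightarrow> 0"
      using tendsto_mult_right_zero[OF diff, of "norm c"] by simp
    then have lim1: "(\<lambda>n. \<pi> (free_scale c (X n))) \<longlonglongrightarrow> c *\<^sub>C F a"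
      by (rule LIM_zero_cancel[OF tendsto_norm_zero_cancel])
    have "norm (\<pi> (free_star (X n)) - star (F a)) = norm (\<pi> (X n) - F a)" for n
      using star_add[of "\<pi> (X n) - F a" "F a"] cstar_norm_star[of "\<pi> (X n) - F a"]
      by (simp add: \<pi>_def free_eval_star)
    then have "(\<lambda>n. norm (\<pi> (free_star (X n)) - star (F a))) \<longlonglongrightarrow> 0"
      using diff by simp
    then have lim2: "(\<lambda>n. \<pi> (free_star (X n))) \<longlonglongrightarrow> star (F a)"
      by (rule LIM_zero_cancel[OF tendsto_norm_zero_cancel])
    show ?thesis
      using LIMSEQ_unique[OF F[OF sn_Cauchy_scale[OF cstar_seminorm_full X(1)]] lim1]
        LIMSEQ_unique[OF F[OF sn_Cauchy_star[OF cstar_seminorm_full X(1)]] lim2]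
      unfolding eq by blast
  qed
  ultimately have "star_homomorphism F" by (simp add: star_homomorphism_def)
  then show thesis
    by (rule that[of F]) (simp_all add: bound' embed gens full_isometry_def full_projection_def)
qed

theorem full_cstar_hom_eqI:
  fixes F G :: "'a::left_cancel_monoid full_cstar \<Rightarrow> 'b::cstar_algebra"
  assumes F: "star_homomorphism F" "continuous_on UNIV F"
    and G: "star_homomorphism G" "continuous_on UNIV G"
    and v: "\<And>p. F (full_isometry p) = G (full_isometry p)"
    and e: "\<And>X. F (full_projection X) = G (full_projection X)"
  shows "F = G"
proof -
  define S where "S = {x. F (full_embed x) = G (full_embed x)}"
  note hom = F(1)[unfolded star_homomorphism_def] G(1)[unfolded star_homomorphism_def]
  have star: "x \<in> S \<Longrightarrow> free_star x \<in> S" and mult: "x \<in> S \<Longrightarrow> y \<in> S \<Longrightarrow> x * y \<in> S"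
    and add: "x \<in> S \<Longrightarrow> y \<in> S \<Longrightarrow> x + y \<in> S" and scale: "x \<in> S \<Longrightarrow> free_scale c x \<in> S" for x y c
    using hom by (simp_all add: S_def full_embed_star full_embed_mult full_embed_add full_embed_scale)
  have gen: "free_gen g \<in> S" for g
    using v e by (cases g) (simp_all add: S_def full_isometry_def full_projection_def gen_v_def gen_e_def)
  have "full_embed (gen_e cideal_whole) = (full_embed 1 :: 'a full_cstar)"
    by (rule full_embed_relator[OF relators.one])
  then have one: "1 \<in> S"
    using gen[of "Proj cideal_whole"] by (simp add: S_def gen_e_def)
  have letter: "Poly_Mapping.single (Word [a]) 1 \<in> S" for a
  proof (cases a)
    case (Gen g) then show ?thesis using gen[of g] by (simp add: free_gen_def)
  next
    case (Adj g) then show ?thesis using star[OF gen[of g]]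
      by (simp add: free_gen_def free_star_single word_star_def)
  qed
  have word: "Poly_Mapping.single (Word l) 1 \<in> S" for l
  proof (induction l)
    case Nil
    then show ?case using one by (simp add: zero_star_word_def[symmetric])
  next
    case (Cons a l)
    then show ?case using mult[OF letter[of a] Cons] by (simp add: mult_single plus_star_word_def)
  qed
  have S: "x \<in> S" for x
  proof (induction x rule: poly_mapping_add_induct)
    case zero
    then show ?case using scale[OF one, of 0] by (simp add: free_scale_zero_left)
  next
    case (single w c)
    then show ?case using scale[OF word[of "letters w"], of c] by (simp add: free_scale_single)
  qed (rule add)
  show "F = G"
  proof
    fix a :: "'a full_cstar"
    obtain X where X: "seminorm_Cauchy full_seminorm X" "a = abs_full_cstar X" by (rule full_cstar_cases)
    have lim: "(\<lambda>n. full_embed (X n)) \<longlonglongrightarrow> a" unfolding X(2) by (rule full_embed_tendsto[OF X(1)])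
    have "(\<lambda>n. F (full_embed (X n))) \<longlonglongrightarrow> F a" "(\<lambda>n. G (full_embed (X n))) \<longlonglongrightarrow> G a"
      using F(2) G(2) lim by (auto intro: continuous_on_tendsto_compose[where s = UNIV])
    then show "F a = G a" using S by (simp add: S_def LIMSEQ_unique)
  qed
qed

end

theory Submission
  imports Defs
begin

text \<open>
  In a right LCM semigroup every non-empty constructible ideal is principal, and
  \<open>e\<^bsub>pS\<^esub> = v\<^sub>p v\<^sub>p\<^sup>*\<close>.  A *-homomorphism that sends \<open>v\<^sub>p\<close> to \<open>v\<^bsub>\<phi>(p)\<^esub>\<close> therefore has no choice but to send
  \<open>e\<^sub>X\<close> to \<open>e\<^bsub>\<phi>(X)S\<^sub>2\<^esub>\<close> for every constructible \<open>X\<close> (\<open>star_homomorphism_full_projection\<close>).  The map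
  \<open>X \<mapsto> \<phi>(X)S\<^sub>2\<close> always respects translation, the empty ideal and the whole semigroup; the displayed
  condition says exactly that it respects intersections.

  If it does, the isometries \<open>v\<^bsub>\<phi>(p)\<^esub>\<close> and the projections \<open>e\<^bsub>\<phi>(X)S\<^sub>2\<^esub>\<close> satisfy the defining relations of
  \<open>C\<^sup>*(S\<^sub>1)\<close>, and the universal property gives the homomorphism.

  Conversely, applying the homomorphism to \<open>e\<^bsub>pS\<^sub>1\<^esub> e\<^bsub>qS\<^sub>1\<^esub> = e\<^bsub>pS\<^sub>1 \<inter> qS\<^sub>1\<^esub>\<close> shows that the projections of the
  two sides of the condition coincide in \<open>C\<^sup>*(S\<^sub>2)\<close>.  To conclude that the ideals coincide, distinct
  constructible ideals must have distinct projections (\<open>inj_full_projection\<close>), so the relations must not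
  collapse in the universal algebra.  This is seen in the left regular representation.
  A C*-seminorm on the free *-algebra that kills the relators is all that is required, so the
  representation can live on the pre-Hilbert space of finitely supported functions, with no completion:
  each generator moves the basis vectors by a partial injection of the semigroup, the adjoint moves them
  by the converse relation, and the operator norm is a C*-seminorm (\<open>cstar_seminorm_operator\<close>).
\<close>

section \<open>Finitely supported functions as a pre-Hilbert space\<close>

definition support :: "('s \<Rightarrow> complex) \<Rightarrow> 's set" where
  "support f = {s. f s \<noteq> 0}"

definition l2norm :: "('s \<Rightarrow> complex) \<Rightarrow> real" where
  "l2norm f = L2_set (\<lambda>s. cmod (f s)) (support f)"

definition inner_prod :: "('s \<Rightarrow> complex) \<Rightarrow> ('s \<Rightarrow> complex) \<Rightarrow> complex" where
  "inner_prod f g = (\<Sum>s\<in>support f. f s * cnj (g s))"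

lemma l2norm_superset:
  assumes "finite A" "support f \<subseteq> A"
  shows "l2norm f = L2_set (\<lambda>s. cmod (f s)) A"
  unfolding l2norm_def L2_set_def
  by (rule arg_cong[of _ _ sqrt], rule sum.mono_neutral_left) (use assms in \<open>auto simp: support_def\<close>)

lemma inner_prod_superset:
  assumes "finite A" "support f \<subseteq> A"
  shows "inner_prod f g = (\<Sum>s\<in>A. f s * cnj (g s))"
  unfolding inner_prod_def
  by (rule sum.mono_neutral_left) (use assms in \<open>auto simp: support_def\<close>)

lemma inner_prod_superset_right:
  assumes "finite (support f)" "finite A" "support g \<subseteq> A"
  shows "inner_prod f g = (\<Sum>s\<in>A. f s * cnj (g s))"
proof -
  have "inner_prod f g = (\<Sum>s\<in>support f \<union> A. f s * cnj (g s))"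
    by (rule inner_prod_superset) (use assms in auto)
  also have "\<dots> = (\<Sum>s\<in>A. f s * cnj (g s))"
    by (rule sum.mono_neutral_right) (use assms in \<open>auto simp: support_def\<close>)
  finally show ?thesis .
qed

lemma finite_support_add:
  "finite (support f) \<Longrightarrow> finite (support g) \<Longrightarrow> finite (support (\<lambda>s. f s + g s))"
  by (rule finite_subset[of _ "support f \<union> support g"]) (auto simp: support_def)

lemma finite_support_scale:
  "finite (support f) \<Longrightarrow> finite (support (\<lambda>s. c * f s))"
  by (rule finite_subset[of _ "support f"]) (auto simp: support_def)

lemma l2norm_nonneg [simp]: "0 \<le> l2norm f"
  by (simp add: l2norm_def)

lemma l2norm_zero [simp]: "l2norm (\<lambda>s. 0) = 0"
  by (simp add: l2norm_def support_def)

lemma l2norm_scale: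
  "l2norm (\<lambda>s. c * f s) = cmod c * l2norm f"
proof (cases "c = 0")
  case False
  then have "support (\<lambda>s. c * f s) = support f" by (simp add: support_def)
  then show ?thesis by (simp add: l2norm_def norm_mult L2_set_right_distrib)
qed simp

lemma l2norm_add:
  assumes "finite (support f)" "finite (support g)"
  shows "l2norm (\<lambda>s. f s + g s) \<le> l2norm f + l2norm g"
proof -
  let ?A = "support f \<union> support g"
  have eq: "l2norm (\<lambda>s. f s + g s) = L2_set (\<lambda>s. cmod (f s + g s)) ?A"
    "l2norm f = L2_set (\<lambda>s. cmod (f s)) ?A" "l2norm g = L2_set (\<lambda>s. cmod (g s)) ?A"
    by (rule l2norm_superset; use assms in \<open>auto simp: support_def\<close>)+
  have "L2_set (\<lambda>s. cmod (f s + g s)) ?A \<le> L2_set (\<lambda>s. cmod (f s) + cmod (g s)) ?A"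
    by (intro L2_set_mono norm_triangle_ineq) auto
  also have "\<dots> \<le> L2_set (\<lambda>s. cmod (f s)) ?A + L2_set (\<lambda>s. cmod (g s)) ?A"
    by (rule L2_set_triangle_ineq)
  finally show ?thesis unfolding eq .
qed

lemma inner_prod_self: "inner_prod f f = of_real ((l2norm f)\<^sup>2)"
proof -
  have "inner_prod f f = (\<Sum>s\<in>support f. of_real ((cmod (f s))\<^sup>2))"
    by (simp only: inner_prod_def complex_norm_square)
  then show ?thesis by (simp add: l2norm_def L2_set_def sum_nonneg)
qed

lemma inner_prod_Cauchy_Schwarz:
  assumes "finite (support f)" "finite (support g)"
  shows "cmod (inner_prod f g) \<le> l2norm f * l2norm g"
proof -
  let ?A = "support f \<union> support g"
  have eq: "inner_prod f g = (\<Sum>s\<in>?A. f s * cnj (g s))"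
    by (rule inner_prod_superset) (use assms in auto)
  have nrm: "l2norm f = L2_set (\<lambda>s. cmod (f s)) ?A" "l2norm g = L2_set (\<lambda>s. cmod (g s)) ?A"
    by (rule l2norm_superset; use assms in auto)+
  have "cmod (inner_prod f g) \<le> (\<Sum>s\<in>?A. \<bar>cmod (f s)\<bar> * \<bar>cmod (g s)\<bar>)"
    unfolding eq by (rule order_trans[OF norm_sum]) (simp add: norm_mult)
  also have "\<dots> \<le> L2_set (\<lambda>s. cmod (f s)) ?A * L2_set (\<lambda>s. cmod (g s)) ?A"
    by (rule L2_set_mult_ineq)
  finally show ?thesis by (simp add: nrm)
qed

lemma inner_prod_add_left:
  assumes "finite (support f)" "finite (support g)"
  shows "inner_prod (\<lambda>s. f s + g s) h = inner_prod f h + inner_prod g h"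
proof -
  let ?A = "support f \<union> support g"
  have "inner_prod (\<lambda>s. f s + g s) h = (\<Sum>s\<in>?A. (f s + g s) * cnj (h s))"
    "inner_prod f h = (\<Sum>s\<in>?A. f s * cnj (h s))" "inner_prod g h = (\<Sum>s\<in>?A. g s * cnj (h s))"
    by (rule inner_prod_superset; use assms in \<open>auto simp: support_def\<close>)+
  then show ?thesis by (simp add: distrib_right sum.distrib)
qed

lemma inner_prod_add_right:
  "inner_prod f (\<lambda>s. g s + h s) = inner_prod f g + inner_prod f h"
  by (simp add: inner_prod_def distrib_left sum.distrib)

lemma inner_prod_scale_left: "inner_prod (\<lambda>s. c * f s) g = c * inner_prod f g"
proof (cases "c = 0")
  case False
  then have "support (\<lambda>s. c * f s) = support f" by (simp add: support_def)
  then show ?thesis by (simp add: inner_prod_def sum_distrib_left mult.assoc)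
qed (simp add: inner_prod_def support_def)

lemma inner_prod_scale_right: "inner_prod f (\<lambda>s. c * g s) = cnj c * inner_prod f g"
  by (simp add: inner_prod_def sum_distrib_left mult.left_commute)


section \<open>Partial isometries given by partial injections\<close>

text \<open>Partial injections are encoded as relations, so that adjoints become converses and products
  become relational compositions.\<close>

definition partial_injection :: "('s \<times> 's) set \<Rightarrow> bool" where
  "partial_injection W \<longleftrightarrow> single_valued W \<and> single_valued (W\<inverse>)"

text \<open>For a partial injection \<open>W\<close> the sum has at most one term, and the operator maps the basis vector
  at \<open>t\<close> to the one at \<open>s\<close> whenever \<open>(s, t) \<in> W\<close>.  Summing over the image is a uniform way of
  writing the value \<open>0\<close> at points outside the domain of \<open>W\<close>.\<close>

definition partial_isometry :: "('s \<times> 's) set \<Rightarrow> ('s \<Rightarrow> complex) \<Rightarrow> 's \<Rightarrow> complex" where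
  "partial_isometry W f s = (\<Sum>t\<in>W `` {s}. f t)"

lemma partial_injection_Id: "partial_injection Id"
  by (simp add: partial_injection_def single_valued_Id)

lemma partial_injection_relcomp:
  "partial_injection V \<Longrightarrow> partial_injection W \<Longrightarrow> partial_injection (V O W)"
  by (simp add: partial_injection_def single_valued_relcomp converse_relcomp)

lemma partial_injection_converse: "partial_injection W \<Longrightarrow> partial_injection (W\<inverse>)"
  by (simp add: partial_injection_def)

lemma partial_injection_Image_cases:
  assumes "partial_injection W"
  obtains "W `` {s} = {}" | t where "(s, t) \<in> W" "W `` {s} = {t}"
proof (cases "W `` {s} = {}")
  case False
  then obtain t where "(s, t) \<in> W" by auto
  moreover have "W `` {s} = {t}"
    using assms \<open>(s, t) \<in> W\<close> by (auto simp: partial_injection_def dest: single_valuedD)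
  ultimately show ?thesis by (rule that(2))
qed (rule that(1))

lemma partial_isometry_Id: "partial_isometry Id f = f"
  by (rule ext) (simp add: partial_isometry_def)

lemma partial_isometry_Id_on: "partial_isometry (Id_on X) f s = (if s \<in> X then f s else 0)"
proof -
  have "Id_on X `` {s} = (if s \<in> X then {s} else {})" by auto
  then show ?thesis by (simp add: partial_isometry_def)
qed

lemma partial_isometry_relcomp:
  assumes "partial_injection V"
  shows "partial_isometry (V O W) f = partial_isometry V (partial_isometry W f)"
proof
  fix s
  show "partial_isometry (V O W) f s = partial_isometry V (partial_isometry W f) s"
    by (rule partial_injection_Image_cases[OF assms, of s])
      (simp_all add: partial_isometry_def relcomp_Image)
qed

lemma partial_isometry_add:
  "partial_isometry W (\<lambda>s. f s + g s) = (\<lambda>s. partial_isometry W f s + partial_isometry W g s)"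
  by (rule ext) (simp add: partial_isometry_def sum.distrib)

lemma partial_isometry_scale:
  "partial_isometry W (\<lambda>s. c * f s) = (\<lambda>s. c * partial_isometry W f s)"
  by (rule ext) (simp add: partial_isometry_def sum_distrib_left)

lemma finite_support_partial_isometry:
  assumes W: "partial_injection W" and f: "finite (support f)"
  shows "finite (support (partial_isometry W f))"
proof (rule finite_subset)
  show "support (partial_isometry W f) \<subseteq> W\<inverse> `` support f"
  proof
    fix s assume s: "s \<in> support (partial_isometry W f)"
    show "s \<in> W\<inverse> `` support f"
      by (rule partial_injection_Image_cases[OF W, of s])
        (use s in \<open>auto simp: partial_isometry_def support_def\<close>)
  qed
  have "finite (W\<inverse> `` {t})" for t
    by (rule partial_injection_Image_cases[OF partial_injection_converse[OF W], of t]) simp_all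
  moreover have "W\<inverse> `` support f = (\<Union>t\<in>support f. W\<inverse> `` {t})" by auto
  ultimately show "finite (W\<inverse> `` support f)" using f by simp
qed

text \<open>Both sides are the sum of \<open>f t * cnj (g s)\<close> over the pairs \<open>(s, t) \<in> W\<close> in the product of the
  supports.\<close>

lemma partial_isometry_adjoint:
  assumes W: "partial_injection W" and f: "finite (support f)" and g: "finite (support g)"
  shows "inner_prod (partial_isometry W f) g = inner_prod f (partial_isometry (W\<inverse>) g)"
proof -
  have restrict: "(\<Sum>t\<in>V `` {s}. h t) = (\<Sum>t | t \<in> support h \<and> (s, t) \<in> V. h t)"
    if V: "partial_injection V" for V and h :: "'a \<Rightarrow> complex" and s
    by (rule sum.mono_neutral_right; rule partial_injection_Image_cases[OF V, of s])
      (auto simp: support_def)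
  have "inner_prod (partial_isometry W f) g = (\<Sum>s\<in>support g. partial_isometry W f s * cnj (g s))"
    by (rule inner_prod_superset_right) (use finite_support_partial_isometry[OF W f] g in auto)
  also have "\<dots> = (\<Sum>s\<in>support g. \<Sum>t | t \<in> support f \<and> (s, t) \<in> W. f t * cnj (g s))"
    by (simp add: partial_isometry_def restrict[OF W] sum_distrib_right)
  also have "\<dots> = (\<Sum>t\<in>support f. \<Sum>s | s \<in> support g \<and> (s, t) \<in> W. f t * cnj (g s))"
    by (rule sum.swap_restrict[OF g f])
  also have "\<dots> = inner_prod f (partial_isometry (W\<inverse>) g)"
    by (simp add: inner_prod_def partial_isometry_def restrict[OF partial_injection_converse[OF W]]
        sum_distrib_left)
  finally show ?thesis .
qed

text \<open>Injectivity of \<open>W\<close> ensures that each value of \<open>f\<close> is used at most once.\<close>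

lemma l2norm_partial_isometry_le:
  assumes W: "partial_injection W" and f: "finite (support f)"
  shows "l2norm (partial_isometry W f) \<le> l2norm f"
proof -
  let ?h = "partial_isometry W f"
  have "\<exists>t. \<forall>s. s \<in> support ?h \<longrightarrow> (s, t s) \<in> W \<and> ?h s = f (t s)"
  proof (intro choice allI)
    fix s
    show "\<exists>t. s \<in> support ?h \<longrightarrow> (s, t) \<in> W \<and> ?h s = f t"
      by (rule partial_injection_Image_cases[OF W, of s])
        (auto simp: partial_isometry_def support_def)
  qed
  then obtain t where t: "\<And>s. s \<in> support ?h \<Longrightarrow> (s, t s) \<in> W" "\<And>s. s \<in> support ?h \<Longrightarrow> ?h s = f (t s)"
    by blast
  have inj: "inj_on t (support ?h)"
    using W t(1) unfolding partial_injection_def by (intro inj_onI) (metis converseI single_valuedD)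
  have "(\<Sum>s\<in>support ?h. (cmod (?h s))\<^sup>2) = (\<Sum>s\<in>support ?h. (cmod (f (t s)))\<^sup>2)"
    by (rule sum.cong) (simp_all add: t(2))
  also have "\<dots> = (\<Sum>u\<in>t ` support ?h. (cmod (f u))\<^sup>2)"
    by (simp add: sum.reindex[OF inj])
  also have "\<dots> \<le> (\<Sum>u\<in>support f. (cmod (f u))\<^sup>2)"
  proof (rule sum_mono2[OF f])
    show "t ` support ?h \<subseteq> support f"
      using t(2) by (auto simp: support_def)
  qed simp
  finally show ?thesis by (simp add: l2norm_def L2_set_def)
qed


section \<open>The C*-seminorm of a family of partial injections\<close>

fun letter_relation :: "('g \<Rightarrow> ('s \<times> 's) set) \<Rightarrow> 'g letter \<Rightarrow> ('s \<times> 's) set" where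
  "letter_relation R (Gen g) = R g"
| "letter_relation R (Adj g) = (R g)\<inverse>"

definition word_relation :: "('g \<Rightarrow> ('s \<times> 's) set) \<Rightarrow> 'g star_word \<Rightarrow> ('s \<times> 's) set" where
  "word_relation R w = foldr (\<lambda>a W. letter_relation R a O W) (letters w) Id"

definition represent ::
  "('g \<Rightarrow> ('s \<times> 's) set) \<Rightarrow> 'g free_star_algebra \<Rightarrow> ('s \<Rightarrow> complex) \<Rightarrow> 's \<Rightarrow> complex" where
  "represent R x f s =
     (\<Sum>w\<in>Poly_Mapping.keys x. Poly_Mapping.lookup x w * partial_isometry (word_relation R w) f s)"

definition operator_seminorm :: "('g \<Rightarrow> ('s \<times> 's) set) \<Rightarrow> 'g free_star_algebra \<Rightarrow> real" where
  "operator_seminorm R x = Sup {l2norm (represent R x f) |f. finite (support f) \<and> l2norm f \<le> 1}"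

lemma word_relation_zero: "word_relation R 0 = Id"
  by (simp add: word_relation_def zero_star_word_def)

lemma word_relation_add: "word_relation R (v + w) = word_relation R v O word_relation R w"
proof -
  have "foldr (\<lambda>a W. letter_relation R a O W) l V = foldr (\<lambda>a W. letter_relation R a O W) l Id O V"
    for l V by (induction l) auto
  from this[of "letters v" "word_relation R w"] show ?thesis
    by (simp add: word_relation_def plus_star_word_def)
qed

lemma word_relation_star: "word_relation R (word_star w) = (word_relation R w)\<inverse>"
proof -
  have single: "word_relation R (Word [letter_star a]) = (word_relation R (Word [a]))\<inverse>" for a
    by (cases a) (simp_all add: word_relation_def)
  have "word_relation R (word_star (Word l)) = (word_relation R (Word l))\<inverse>" for l
  proof (induction l)
    case Nil
    then show ?case by (simp add: word_relation_def word_star_def)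
  next
    case (Cons a l)
    have "Word (a # l) = Word [a] + Word l" by (simp add: plus_star_word_def)
    moreover have "word_star (Word [a]) = Word [letter_star a]" by (simp add: word_star_def)
    ultimately show ?case
      by (simp add: word_star_add word_relation_add Cons single converse_relcomp)
  qed
  from this[of "letters w"] show ?thesis by simp
qed

lemma representation_superset:
  assumes "finite A" "Poly_Mapping.keys x \<subseteq> A"
  shows "represent R x f s =
    (\<Sum>w\<in>A. Poly_Mapping.lookup x w * partial_isometry (word_relation R w) f s)"
  unfolding represent_def
  by (rule sum.mono_neutral_left) (use assms in \<open>auto simp: in_keys_iff\<close>)

lemma representation_zero: "represent R 0 f = (\<lambda>s. 0)"
  by (rule ext) (simp add: represent_def)

lemma representation_single:
  "represent R (Poly_Mapping.single w c) f = (\<lambda>s. c * partial_isometry (word_relation R w) f s)"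
  by (rule ext) (simp add: represent_def)

lemma representation_add:
  "represent R (x + y) f = (\<lambda>s. represent R x f s + represent R y f s)"
proof
  fix s
  let ?A = "Poly_Mapping.keys x \<union> Poly_Mapping.keys y"
  let ?u = "\<lambda>w. partial_isometry (word_relation R w) f s"
  have "represent R (x + y) f s = (\<Sum>w\<in>?A. Poly_Mapping.lookup (x + y) w * ?u w)"
    by (rule representation_superset) (use Poly_Mapping.keys_add[of x y] in auto)
  also have "\<dots> = (\<Sum>w\<in>?A. Poly_Mapping.lookup x w * ?u w) + (\<Sum>w\<in>?A. Poly_Mapping.lookup y w * ?u w)"
    by (simp add: lookup_add distrib_right sum.distrib)
  also have "\<dots> = represent R x f s + represent R y f s"
    by (simp add: representation_superset[of ?A x] representation_superset[of ?A y])
  finally show "represent R (x + y) f s = represent R x f s + represent R y f s" .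
qed

lemma representation_diff:
  "represent R (x - y) f = (\<lambda>s. represent R x f s - represent R y f s)"
  using representation_add[of R "x - y" y f] by (simp add: fun_eq_iff)

lemma representation_one: "represent R 1 f = f"
  unfolding single_one[symmetric] representation_single
  by (simp add: word_relation_zero partial_isometry_Id)

lemma representation_gen: "represent R (free_gen g) f = partial_isometry (R g) f"
  by (simp add: free_gen_def representation_single word_relation_def)

lemma representation_gen_star:
  "represent R (free_star (free_gen g)) f = partial_isometry ((R g)\<inverse>) f"
  by (simp add: free_gen_def free_star_single representation_single word_relation_star)
    (simp add: word_relation_def)

lemma representation_vector_add:
  "represent R x (\<lambda>s. f s + g s) = (\<lambda>s. represent R x f s + represent R x g s)"
  by (rule ext) (simp add: represent_def partial_isometry_add distrib_left sum.distrib)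

lemma representation_vector_scale:
  "represent R x (\<lambda>s. c * f s) = (\<lambda>s. c * represent R x f s)"
  by (rule ext) (simp add: represent_def partial_isometry_scale sum_distrib_left mult.left_commute)

context
  fixes R :: "'g \<Rightarrow> ('s \<times> 's) set"
  assumes R: "\<And>g. partial_injection (R g)"
begin

lemma partial_injection_word: "partial_injection (word_relation R w)"
proof -
  have "partial_injection (letter_relation R a)" for a
    by (cases a) (simp_all add: R partial_injection_converse)
  then have "partial_injection (foldr (\<lambda>a W. letter_relation R a O W) l Id)" for l
    by (induction l) (simp_all add: partial_injection_Id partial_injection_relcomp)
  then show ?thesis by (simp add: word_relation_def)
qed

lemma representation_mult: "represent R (x * y) f = represent R x (represent R y f)"
proof (induction x rule: poly_mapping_add_induct)
  case (single v c)
  show ?case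
  proof (induction y rule: poly_mapping_add_induct)
    case zero
    have "represent R x (\<lambda>s. 0) = (\<lambda>s. 0)" for x
      using representation_vector_scale[of R x 0 f] by simp
    then show ?case by (simp add: representation_zero)
  next
    case (single w d)
    show ?case
      by (simp add: mult_single representation_single word_relation_add partial_isometry_scale
          partial_isometry_relcomp[OF partial_injection_word] mult.assoc)
  qed (simp add: distrib_left representation_add representation_vector_add)
qed (simp_all add: representation_zero distrib_right representation_add)

lemma finite_support_representation:
  assumes "finite (support f)" shows "finite (support (represent R x f))"
proof (induction x rule: poly_mapping_add_induct)
  case zero
  then show ?case by (simp add: representation_zero support_def)
next
  case (single w c)
  then show ?case
    by (simp add: representation_single finite_support_scale assms
        finite_support_partial_isometry[OF partial_injection_word])
qed (simp add: representation_add finite_support_add)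

text \<open>Words act as contractions, so the sum of the moduli of the coefficients is a bound.  Without it
  the supremum defining the operator seminorm would be meaningless.\<close>

lemma representation_bounded:
  "\<exists>K\<ge>0. \<forall>f. finite (support f) \<longrightarrow> l2norm (represent R x f) \<le> K * l2norm f"
proof (induction x rule: poly_mapping_add_induct)
  case zero
  then show ?case by (intro exI[of _ 0]) (simp add: representation_zero)
next
  case (single w c)
  show ?case
    by (rule exI[of _ "cmod c"])
      (simp add: representation_single l2norm_scale mult_left_mono
        l2norm_partial_isometry_le[OF partial_injection_word])
next
  case (add x y)
  then obtain K L where K: "K \<ge> 0" "L \<ge> 0"
    and x: "\<And>f. finite (support f) \<Longrightarrow> l2norm (represent R x f) \<le> K * l2norm f"
    and y: "\<And>f. finite (support f) \<Longrightarrow> l2norm (represent R y f) \<le> L * l2norm f"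
    by metis
  have "l2norm (represent R (x + y) f) \<le> (K + L) * l2norm f" if f: "finite (support f)" for f
    using l2norm_add[OF finite_support_representation[OF f, of x] finite_support_representation[OF f, of y]]
      x[OF f] y[OF f] by (simp add: representation_add distrib_right)
  then show ?case using K by (intro exI[of _ "K + L"]) auto
qed

lemma representation_adjoint:
  assumes f: "finite (support f)" and g: "finite (support g)"
  shows "inner_prod (represent R x f) g = inner_prod f (represent R (free_star x) g)"
proof (induction x rule: poly_mapping_add_induct)
  case zero
  then show ?case by (simp add: free_star_zero representation_zero inner_prod_def support_def)
next
  case (single w c)
  then show ?case
    by (simp add: free_star_single representation_single inner_prod_scale_left inner_prod_scale_right
        word_relation_star partial_isometry_adjoint[OF partial_injection_word f g])
next
  case (add x y)
  then show ?case
    by (simp add: free_star_add representation_add inner_prod_add_right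
        inner_prod_add_left[OF finite_support_representation[OF f] finite_support_representation[OF f]])
qed

lemma operator_seminorm_upper:
  assumes "finite (support f)" "l2norm f \<le> 1"
  shows "l2norm (represent R x f) \<le> operator_seminorm R x"
  unfolding operator_seminorm_def
proof (rule cSup_upper)
  obtain K where K: "K \<ge> 0" "\<And>f. finite (support f) \<Longrightarrow> l2norm (represent R x f) \<le> K * l2norm f"
    using representation_bounded[of x] by blast
  have "l2norm (represent R x f) \<le> K" if "finite (support f)" "l2norm f \<le> 1" for f
    using K(2)[OF that(1)] mult_left_le[OF that(2) K(1)] by linarith
  then show "bdd_above {l2norm (represent R x f) |f. finite (support f) \<and> l2norm f \<le> 1}"
    by (auto intro!: bdd_aboveI[where M = K])
qed (use assms in blast)

lemma operator_seminorm_least: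
  assumes "\<And>f. finite (support f) \<Longrightarrow> l2norm f \<le> 1 \<Longrightarrow> l2norm (represent R x f) \<le> K"
  shows "operator_seminorm R x \<le> K"
  unfolding operator_seminorm_def
proof (rule cSup_least)
  have "finite (support (\<lambda>s::'s. 0)) \<and> l2norm (\<lambda>s::'s. 0) \<le> 1" by (simp add: support_def)
  then show "{l2norm (represent R x f) |f. finite (support f) \<and> l2norm f \<le> 1} \<noteq> {}" by blast
qed (use assms in blast)

lemma operator_seminorm_nonneg: "0 \<le> operator_seminorm R x"
  by (rule order_trans[OF l2norm_nonneg operator_seminorm_upper[of "\<lambda>s. 0"]])
    (simp_all add: support_def)

lemma l2norm_representation_le:
  assumes f: "finite (support f)"
  shows "l2norm (represent R x f) \<le> operator_seminorm R x * l2norm f"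
proof (cases "l2norm f = 0")
  case True
  obtain K where "l2norm (represent R x f) \<le> K * l2norm f"
    using representation_bounded[of x] f by blast
  then show ?thesis using True by simp
next
  case False
  let ?c = "complex_of_real (inverse (l2norm f))"
  have "l2norm (\<lambda>s. ?c * f s) = 1"
    unfolding l2norm_scale norm_of_real using False l2norm_nonneg[of f] by simp
  then have "l2norm (represent R x (\<lambda>s. ?c * f s)) \<le> operator_seminorm R x"
    by (intro operator_seminorm_upper finite_support_scale f) simp
  then have "inverse (l2norm f) * l2norm (represent R x f) \<le> operator_seminorm R x"
    unfolding representation_vector_scale l2norm_scale norm_of_real using l2norm_nonneg[of f] by simp
  then show ?thesis using False l2norm_nonneg[of f] by (simp add: field_simps)
qed

text \<open>The inequality \<open>\<parallel>x\<parallel>\<^sup>2 \<le> \<parallel>x\<^sup>*x\<parallel>\<close> is Cauchy-Schwarz applied to \<open>\<parallel>xf\<parallel>\<^sup>2 = \<langle>f, x\<^sup>*xf\<rangle>\<close>.  By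
  submultiplicativity it gives \<open>\<parallel>x\<parallel> \<le> \<parallel>x\<^sup>*\<parallel>\<close>, hence equality of the two, and then the reverse
  inequality.\<close>

lemma cstar_seminorm_operator: "cstar_seminorm (operator_seminorm R)"
proof -
  let ?N = "operator_seminorm R"
  have add: "?N (x + y) \<le> ?N x + ?N y" for x y
  proof (rule operator_seminorm_least)
    fix f :: "'s \<Rightarrow> complex" assume f: "finite (support f)" "l2norm f \<le> 1"
    show "l2norm (represent R (x + y) f) \<le> ?N x + ?N y"
      using l2norm_add[OF finite_support_representation[OF f(1), of x]
          finite_support_representation[OF f(1), of y]]
        operator_seminorm_upper[OF f, of x] operator_seminorm_upper[OF f, of y]
      by (simp add: representation_add)
  qed
  have mult: "?N (x * y) \<le> ?N x * ?N y" for x y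
  proof (rule operator_seminorm_least)
    fix f :: "'s \<Rightarrow> complex" assume f: "finite (support f)" "l2norm f \<le> 1"
    have "l2norm (represent R (x * y) f) \<le> ?N x * l2norm (represent R y f)"
      by (simp add: representation_mult l2norm_representation_le finite_support_representation f)
    also have "\<dots> \<le> ?N x * ?N y"
      by (intro mult_left_mono operator_seminorm_upper f operator_seminorm_nonneg)
    finally show "l2norm (represent R (x * y) f) \<le> ?N x * ?N y" .
  qed
  have scale_rep: "represent R (free_scale c x) f = (\<lambda>s. c * represent R x f s)" for c x f
    by (simp add: free_scale_conv_mult representation_mult representation_single word_relation_zero
        partial_isometry_Id)
  have scale_le: "?N (free_scale c x) \<le> cmod c * ?N x" for c x
    by (rule operator_seminorm_least)
      (simp add: scale_rep l2norm_scale mult_left_mono operator_seminorm_upper)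
  have scale: "?N (free_scale c x) = cmod c * ?N x" for c x
  proof (cases "c = 0")
    case True
    then show ?thesis using scale_le[of c x] operator_seminorm_nonneg[of "free_scale c x"] by simp
  next
    case False
    have "?N x \<le> cmod (inverse c) * ?N (free_scale c x)"
      using scale_le[of "inverse c" "free_scale c x"] False by (simp add: free_scale_scale free_scale_one)
    then show ?thesis
      using scale_le[of c x] False by (simp add: norm_inverse norm_divide field_simps)
  qed
  have square_le: "(?N x)\<^sup>2 \<le> ?N (free_star x * x)" for x
  proof -
    have "?N x \<le> sqrt (?N (free_star x * x))"
    proof (rule operator_seminorm_least)
      fix f :: "'s \<Rightarrow> complex" assume f: "finite (support f)" "l2norm f \<le> 1"
      let ?g = "represent R x f"
      have g: "finite (support ?g)" by (rule finite_support_representation[OF f(1)])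
      have "(l2norm ?g)\<^sup>2 = cmod (inner_prod ?g ?g)"
        unfolding inner_prod_self norm_of_real by simp
      also have "inner_prod ?g ?g = inner_prod f (represent R (free_star x * x) f)"
        by (simp add: representation_adjoint[OF f(1) g] representation_mult)
      also have "cmod \<dots> \<le> l2norm f * l2norm (represent R (free_star x * x) f)"
        by (intro inner_prod_Cauchy_Schwarz finite_support_representation f)
      also have "\<dots> \<le> 1 * ?N (free_star x * x)"
        by (intro mult_mono operator_seminorm_upper f) simp_all
      finally show "l2norm ?g \<le> sqrt (?N (free_star x * x))" by (intro real_le_rsqrt) simp
    qed
    then show ?thesis
      using power_mono[of "?N x" "sqrt (?N (free_star x * x))" 2]
      by (simp add: operator_seminorm_nonneg)
  qed
  have le_star: "?N x \<le> ?N (free_star x)" for x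
  proof -
    have "?N x * ?N x \<le> ?N (free_star x) * ?N x"
      using square_le[of x] mult[of "free_star x" x] by (simp add: power2_eq_square)
    then show ?thesis
      using operator_seminorm_nonneg[of x] operator_seminorm_nonneg[of "free_star x"]
      by (cases "?N x = 0") (auto simp: mult_le_cancel_right)
  qed
  have "?N (free_star x) = ?N x" for x
    using le_star[of x] le_star[of "free_star x"] by (simp add: free_star_star)
  then have "?N (free_star x * x) = (?N x)\<^sup>2" for x
    using mult[of "free_star x" x] square_le[of x] by (simp add: power2_eq_square)
  then show ?thesis unfolding cstar_seminorm_def using add mult scale by simp
qed

end


section \<open>The left regular representation separates the constructible ideals\<close>

fun regular_relation :: "('a::left_cancel_monoid, 'a cideal) generator \<Rightarrow> ('a \<times> 'a) set" where
  "regular_relation (Isom p) = {(p * t, t) |t. True}"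
| "regular_relation (Proj X) = Id_on (Rep_cideal X)"

lemma partial_injection_regular: "partial_injection (regular_relation g)"
  by (cases g) (auto simp: partial_injection_def single_valued_def dest: left_cancel)

text \<open>Products of the operators correspond to compositions of the relations, which turns each relator
  into an identity between partial injections.\<close>

lemma representation_regular_relator:
  assumes "r \<in> relators"
  shows "represent regular_relation r f = (\<lambda>s. 0)"
proof -
  note compose = partial_isometry_relcomp[symmetric]
    partial_injection_regular[of "Isom p" for p, simplified]
    partial_injection_regular[of "Proj X" for X, simplified]
    partial_injection_converse partial_injection_relcomp
  note operators = representation_diff representation_mult[where R = regular_relation, OF partial_injection_regular]
    representation_gen representation_gen_star representation_one gen_v_def gen_e_def
  show ?thesis
    using assms
  proof cases
    case (isom p)
    have "{(p * t, t) |t. True}\<inverse> O {(p * t, t) |t. True} = Id" by (auto dest: left_cancel)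
    then show ?thesis by (simp add: isom operators compose partial_isometry_Id)
  next
    case (proj_star X)
    then show ?thesis by (simp add: operators)
  next
    case (proj_idem X)
    have "Id_on Y O Id_on Y = Id_on Y" for Y :: "'a set" by auto
    then show ?thesis by (simp add: proj_idem operators compose)
  next
    case (mult p q)
    have "{(p * t, t) |t. True} O {(q * t, t) |t. True} = {(p * q * t, t) |t. True}"
      by (auto simp: mult.assoc)
    then show ?thesis by (simp add: mult operators compose)
  next
    case (translate p X)
    have "({(p * t, t) |t. True} O Id_on (Rep_cideal X)) O {(p * t, t) |t. True}\<inverse> =
        Id_on (Rep_cideal (cideal_mult p X))"
      by (auto simp: cideal_mult.rep_eq)
    then show ?thesis by (simp add: translate operators compose flip: O_assoc)
  next
    case zero
    then show ?thesis by (simp add: fun_eq_iff operators partial_isometry_def cideal_empty.rep_eq)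
  next
    case one
    then show ?thesis by (simp add: fun_eq_iff operators partial_isometry_Id_on cideal_whole.rep_eq)
  next
    case (inter X Y)
    have "Id_on (Rep_cideal X) O Id_on (Rep_cideal Y) = Id_on (Rep_cideal (cideal_inter X Y))"
      by (auto simp: cideal_inter.rep_eq)
    then show ?thesis by (simp add: inter operators compose)
  qed
qed

text \<open>A point \<open>t\<close> of one ideal outside the other gives a basis vector that is fixed by one projection
  and killed by the other.\<close>

lemma inj_full_projection: "inj (full_projection :: 'a::left_cancel_monoid cideal \<Rightarrow> 'a full_cstar)"
proof -
  have sub: "Rep_cideal X \<subseteq> Rep_cideal Y"
    if eq: "full_projection X = (full_projection Y :: 'a full_cstar)" for X Y :: "'a cideal"
  proof (rule ccontr)
    assume "\<not> Rep_cideal X \<subseteq> Rep_cideal Y"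
    then obtain t where t: "t \<in> Rep_cideal X" "t \<notin> Rep_cideal Y" by blast
    let ?N = "operator_seminorm (regular_relation :: _ \<Rightarrow> ('a \<times> 'a) set)"
    let ?\<delta> = "\<lambda>s. if s = t then 1 else 0 :: complex"
    have supp: "support ?\<delta> = {t}" by (auto simp: support_def)
    then have \<delta>: "finite (support ?\<delta>)" "l2norm ?\<delta> = 1" by (simp_all add: l2norm_def)
    have "represent regular_relation (gen_e X - gen_e Y) ?\<delta> = ?\<delta>"
      using t by (auto simp: fun_eq_iff representation_diff gen_e_def representation_gen
          partial_isometry_Id_on)
    then have "1 \<le> ?N (gen_e X - gen_e Y)"
      using operator_seminorm_upper[where R = regular_relation, OF partial_injection_regular \<delta>(1), where x = "gen_e X - gen_e Y"] \<delta>(2)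
      by simp
    also have "\<dots> \<le> full_seminorm (gen_e X - gen_e Y)"
    proof (rule le_full_seminorm[OF cstar_seminorm_operator[where R = regular_relation, OF partial_injection_regular]])
      fix r :: "'a semigroup_free_algebra" assume "r \<in> relators"
      then have "?N r \<le> 0"
        by (intro operator_seminorm_least[where R = regular_relation, OF partial_injection_regular])
          (simp add: representation_regular_relator)
      then show "?N r = 0"
        using operator_seminorm_nonneg[where R = regular_relation, OF partial_injection_regular, of r] by simp
    qed
    also have "\<dots> = norm (full_projection X - full_projection Y)"
      by (simp add: norm_full_embed full_projection_def flip: full_embed_diff)
    finally show False by (simp add: eq)
  qed
  show ?thesis
    by (rule injI) (metis Rep_cideal_inject sub subset_antisym)
qed


section \<open>Constructible ideals of right LCM semigroups\<close>

lemma constructible_range: "range ((*) p) \<in> constructible"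
  by (rule constructible.image[OF constructible.whole])

text \<open>For preimages: if \<open>pS \<inter> qS = rS\<close> and \<open>r = p t\<close>, then left cancellation gives
  \<open>p\<^sup>-\<^sup>1(qS) = tS\<close>.\<close>

lemma constructible_right_lcm:
  fixes X :: "'a::right_lcm_monoid set"
  assumes "X \<in> constructible"
  shows "X = {} \<or> (\<exists>p. X = range ((*) p))"
  using assms
proof (induction rule: constructible.induct)
  case whole
  have "UNIV = range ((*) (1::'a))" by auto
  then show ?case by blast
next
  case (image X p)
  have "(*) p ` range ((*) q) = range ((*) (p * q))" for q
    by (auto simp: mult.assoc)
  then show ?case using image by blast
next
  case (preimage X p)
  show ?case
  proof (cases "range ((*) p) \<inter> X = {}")
    case True
    then show ?thesis by blast
  next
    case False
    then obtain q where "X = range ((*) q)" using preimage by blast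
    then obtain r where r: "range ((*) p) \<inter> X = range ((*) r)"
      using False right_lcm[of p q] by auto
    then have "r \<in> range ((*) p)" using rangeI[of "(*) r" 1] by auto
    then obtain t where t: "r = p * t" by blast
    have "(*) p -` X = range ((*) t)"
    proof (intro set_eqI iffI)
      fix y assume "y \<in> (*) p -` X"
      then have "p * y \<in> range ((*) r)" using r by blast
      then show "y \<in> range ((*) t)" by (auto simp: t mult.assoc dest: left_cancel)
    next
      fix y assume "y \<in> range ((*) t)"
      then have "p * y \<in> range ((*) r)" by (auto simp: t mult.assoc)
      then show "y \<in> (*) p -` X" using r by blast
    qed
    then show ?thesis by blast
  qed
qed simp

lemma set_mult_image: "set_mult (f ` X) UNIV = (\<Union>x\<in>X. range ((*) (f x)))"
  by (auto simp: set_mult_def)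

context
  fixes \<phi> :: "'a::right_lcm_monoid \<Rightarrow> 'b::right_lcm_monoid"
  assumes phi_one: "\<phi> 1 = 1"
    and phi_mult: "\<And>p q. \<phi> (p * q) = \<phi> p * \<phi> q"
begin

lemma set_mult_image_range: "set_mult (\<phi> ` range ((*) p)) UNIV = range ((*) (\<phi> p))"
proof (intro set_eqI iffI)
  fix y assume "y \<in> range ((*) (\<phi> p))"
  then obtain s where "y = \<phi> (p * 1) * s" by auto
  then show "y \<in> set_mult (\<phi> ` range ((*) p)) UNIV" unfolding set_mult_def by blast
qed (auto simp: set_mult_def phi_mult mult.assoc)

lemma set_mult_image_empty: "set_mult (\<phi> ` {}) UNIV = {}"
  by (simp add: set_mult_def)

text \<open>For a general left cancellative \<open>S\<^sub>1\<close> there is no reason for \<open>\<phi>(X)S\<^sub>2\<close> to be constructible; here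
  \<open>X\<close> is empty or principal, and so is \<open>\<phi>(X)S\<^sub>2\<close>.\<close>

lemma set_mult_image_constructible:
  assumes "X \<in> constructible" shows "set_mult (\<phi> ` X) UNIV \<in> constructible"
  using constructible_right_lcm[OF assms]
  by (auto simp: set_mult_image_range set_mult_image_empty constructible_range constructible.empty
      simp del: image_empty)

lift_definition induced_ideal :: "'a cideal \<Rightarrow> 'b cideal" is "\<lambda>X. set_mult (\<phi> ` X) UNIV"
  by (rule set_mult_image_constructible)

text \<open>The projection of a principal ideal is the range projection \<open>v\<^sub>p v\<^sub>p\<^sup>*\<close>, so the values of \<open>F\<close> on
  the isometries already determine its values on the projections.\<close>

lemma star_homomorphism_full_projection:
  fixes F :: "'a full_cstar \<Rightarrow> 'b full_cstar"
  assumes F: "star_homomorphism F" "\<And>p. F (full_isometry p) = full_isometry (\<phi> p)"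
  shows "F (full_projection X) = full_projection (induced_ideal X)"
proof -
  have hom: "F (x * y) = F x * F y" "F (star x) = star (F x)" "F (c *\<^sub>C x) = c *\<^sub>C F x" for x y c
    using F(1) by (simp_all add: star_homomorphism_def)
  have principal: "full_projection (cideal_mult p cideal_whole) =
      full_isometry p * star (full_isometry p)" for p :: "'c::left_cancel_monoid"
    using full_cstar_relations unfolding semigroup_relations_def by (metis mult_1_right)
  have empty: "full_projection cideal_empty = (0 :: 'c::left_cancel_monoid full_cstar)"
    using full_cstar_relations unfolding semigroup_relations_def by blast
  consider "Rep_cideal X = {}" | p where "Rep_cideal X = range ((*) p)"
    using constructible_right_lcm[OF Rep_cideal] by blast
  then show ?thesis
  proof cases
    case 1
    then have X: "X = cideal_empty" "induced_ideal X = cideal_empty"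
      by (simp_all add: cideal_empty.rep_eq induced_ideal.rep_eq set_mult_def flip: Rep_cideal_inject)
    show ?thesis
      unfolding X(2) unfolding X(1) empty using hom(3)[of 0 0] by (simp add: cstar_scaleC_zero)
  next
    case 2
    then have X: "X = cideal_mult p cideal_whole"
      "induced_ideal X = cideal_mult (\<phi> p) cideal_whole"
      by (simp_all add: cideal_mult.rep_eq cideal_whole.rep_eq induced_ideal.rep_eq
          set_mult_image_range flip: Rep_cideal_inject)
    show ?thesis
      unfolding X(2) unfolding X(1) by (simp add: principal hom F(2))
  qed
qed

lemma induced_ideal_mult: "induced_ideal (cideal_mult p X) = cideal_mult (\<phi> p) (induced_ideal X)"
  by transfer (simp add: set_mult_image image_UN image_image phi_mult mult.assoc)

lemma induced_ideal_empty: "induced_ideal cideal_empty = cideal_empty"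
  by transfer (rule set_mult_image_empty)

lemma induced_ideal_whole: "induced_ideal cideal_whole = cideal_whole"
proof transfer
  show "set_mult (\<phi> ` UNIV) UNIV = UNIV"
    using set_mult_image_range[of 1] phi_one by simp
qed

lemma induced_ideal_inter:
  assumes lcm: "\<And>p q. range ((*) (\<phi> p)) \<inter> range ((*) (\<phi> q)) =
    set_mult (\<phi> ` (range ((*) p) \<inter> range ((*) q))) UNIV"
  shows "induced_ideal (cideal_inter X Y) = cideal_inter (induced_ideal X) (induced_ideal Y)"
proof transfer
  fix X Y :: "'a set" assume "X \<in> constructible" "Y \<in> constructible"
  then consider "X = {} \<or> Y = {}" | p q where "X = range ((*) p)" "Y = range ((*) q)"
    using constructible_right_lcm by blast
  then show "set_mult (\<phi> ` (X \<inter> Y)) UNIV = set_mult (\<phi> ` X) UNIV \<inter> set_mult (\<phi> ` Y) UNIV"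
  proof cases
    case 1
    then show ?thesis by (auto simp: set_mult_def)
  next
    case 2
    then show ?thesis by (simp add: set_mult_image_range lcm)
  qed
qed

end


section \<open>The homomorphism induced by a semigroup homomorphism\<close>

theorem theorem3p3:
  fixes \<phi> :: "'a::right_lcm_monoid \<Rightarrow> 'b::right_lcm_monoid"
  assumes phi_one: "\<phi> 1 = 1"
    and phi_mult: "\<And>p q. \<phi> (p * q) = \<phi> p * \<phi> q"
  shows "(\<exists>F :: 'a full_cstar \<Rightarrow> 'b full_cstar.
            star_homomorphism F \<and> (\<forall>p. F (full_isometry p) = full_isometry (\<phi> p))) \<longleftrightarrow>
         (\<forall>p q. range ((*) (\<phi> p)) \<inter> range ((*) (\<phi> q)) =
                set_mult (\<phi> ` (range ((*) p) \<inter> range ((*) q))) UNIV)"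
    (is "?hom \<longleftrightarrow> ?lcm")
proof -
  note phi = phi_one phi_mult
  have inter: "full_projection X * full_projection Y = full_projection (cideal_inter X Y)"
    for X Y :: "'c::left_cancel_monoid cideal"
    using full_cstar_relations unfolding semigroup_relations_def by blast
  show ?thesis
  proof
    assume ?hom
    then obtain F :: "'a full_cstar \<Rightarrow> 'b full_cstar" where F: "star_homomorphism F"
      "\<And>p. F (full_isometry p) = full_isometry (\<phi> p)" by blast
    note F_proj = star_homomorphism_full_projection[OF phi F]
    show ?lcm
    proof (intro allI)
      fix p q :: 'a
      let ?P = "cideal_mult p cideal_whole" and ?Q = "cideal_mult q cideal_whole"
      have "F (full_projection ?P * full_projection ?Q) =
          F (full_projection ?P) * F (full_projection ?Q)"
        using F(1) by (simp add: star_homomorphism_def)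
      then have "full_projection (induced_ideal \<phi> (cideal_inter ?P ?Q)) =
          full_projection (cideal_inter (induced_ideal \<phi> ?P) (induced_ideal \<phi> ?Q))"
        by (simp add: inter F_proj)
      then have "induced_ideal \<phi> (cideal_inter ?P ?Q) =
          cideal_inter (induced_ideal \<phi> ?P) (induced_ideal \<phi> ?Q)"
        by (rule injD[OF inj_full_projection])
      then show "range ((*) (\<phi> p)) \<inter> range ((*) (\<phi> q)) =
          set_mult (\<phi> ` (range ((*) p) \<inter> range ((*) q))) UNIV"
        by (simp add: induced_ideal.rep_eq[OF phi] cideal_inter.rep_eq cideal_mult.rep_eq
            cideal_whole.rep_eq set_mult_image_range[OF phi] flip: Rep_cideal_inject)
    qed
  next
    assume ?lcm
    then have lcm: "range ((*) (\<phi> p)) \<inter> range ((*) (\<phi> q)) =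
        set_mult (\<phi> ` (range ((*) p) \<inter> range ((*) q))) UNIV" for p q by blast
    have "semigroup_relations (\<lambda>p. full_isometry (\<phi> p)) (\<lambda>X. full_projection (induced_ideal \<phi> X))"
      using full_cstar_relations[where 'a = 'b]
      by (simp add: semigroup_relations_def phi_mult induced_ideal_mult[OF phi]
          induced_ideal_empty[OF phi] induced_ideal_whole[OF phi] induced_ideal_inter[OF phi lcm])
    then obtain F :: "'a full_cstar \<Rightarrow> 'b full_cstar" where "star_homomorphism F"
      "\<And>p. F (full_isometry p) = full_isometry (\<phi> p)"
      by (rule full_cstar_universal) blast
    then show ?hom by blast
  qed
qed

end
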